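(* Let $K$ be a field. Then $SL_3(K)$ is generated by the matrices $$\hat R(a)=\begin{pmatrix}a&0&0\\0&1&0\\0&0&a^{-1}\end{pmatrix}\ (a\in K^\times\setminus\{1\}),\quad \hat S=\begin{pmatrix}-1&1&0\\0&1&0\\0&0&-1\end{pmatrix},\quad \hat J=\begin{pmatrix}0&-1&0\\-1&0&0\\0&0&-1\end{pmatrix},\quad T=\begin{pmatrix}0&0&-1\\0&-1&0\\-1&0&0\end{pmatrix},$$ subject to the following defining relations: (i) $\hat S^2=\hat J^2=T^2=1$; (ii) $\hat R(a)\hat R(b)=\hat R(ab)$ for $a,b\in K^\times\setminus\{1\}$, where $\hat R(1):=1$; (iii) $\hat Z(a)\hat Z(b)=\hat Z(ab)$ for $a,b\in K^\times\setminus\{1\}$, where $\hat Z(a):=(\hat J\hat R(a))^2$; (iv) $[\hat R(a),\hat Z(b)]=1$ for $a,b\in K^\times\setminus\{1\}$; (v) $[\hat S,\hat Z(a)]=1$ for $a\in K^\times\setminus\{1\}$; (vi) $[\hat S,\hat R(a)]=\hat E_{1,2}(1-a)$ for $a\in K^\times\setminus\{1\}$, where $\hat E_{1,2}(a):=\hat R(a)\hat S\hat R(-a)^{-1}$ for $a\in K^\times$; (vii) $(\hat J\hat S)^3=(T\hat J)^3=1$; (viii) $(T\hat R(a))^2=1$ for $a\in K^\times\setminus\{1\}$; (ix) $[\hat Z(a),T]=\hat R(a)^3$ for $a\in K^\times\setminus\{1\}$; (x) $(\hat W\hat E_{1,2}(a))^2=1$ for $a\in\mathcal{R}$, where $\hat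 W:=T\hat S T$ and $\mathcal{R}\subseteq K^\times$ with $1\in\mathcal{R}$ is a set of representatives for the quotient group $K^\times/(K^\times)^3$; (xi) $\hat W\hat J\hat R(a)\hat W=\rho_a\hat W\lambda_a$ for $a\in\mathcal{R}$, where $\rho_a:=\hat E_{1,2}(-a)\hat J\hat R(a)$ and $\lambda_a:=\hat E_{1,2}(-a^{-2})\,\hat J\,\hat E_{1,2}(a^2)\,\hat R(a)^4\,\hat Z(a)^{-2}$.
   Context: "Generated by ... subject to the relations" means that the abstract group with the listed generators and relations is isomorphic to the given group via the indicated assignment of generators to matrices. Commutators are $[x,y]=xyx^{-1}y^{-1}$. $(K^\times)^3$ denotes the subgroup of cubes in $K^\times$. *)

theory Defs
  imports
    "HOL-Analysis.Determinants"
    "HOL-Algebra.Coset"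
begin

(* A letter (x, True) stands for the generator x and (x, False) for its formal inverse. *)
type_synonym 'g word = "('g \<times> bool) list"

definition words :: "'g set \<Rightarrow> 'g word set" where
  "words X = lists (X \<times> UNIV)"

definition winv :: "'g word \<Rightarrow> 'g word" where
  "winv w = rev (map (\<lambda>(x, e). (x, \<not> e)) w)"

definition wpow :: "'g word \<Rightarrow> nat \<Rightarrow> 'g word" where
  "wpow w n = concat (replicate n w)"

definition wcomm :: "'g word \<Rightarrow> 'g word \<Rightarrow> 'g word" where
  "wcomm u v = u @ v @ winv u @ winv v"

text \<open>
  A pair (u, v) in rels is the relation u = v. The group with generators X and relations rels
  consists of the words over X modulo the congruence generated by free cancellation and rels;
  concatenation of words induces its multiplication.
\<close>

inductive_set word_cong :: "'g set \<Rightarrow> ('g word \<times> 'g word) set \<Rightarrow> ('g word \<times> 'g word) set"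
  for X :: "'g set" and rels :: "('g word \<times> 'g word) set" where
  cancel: "x \<in> X \<Longrightarrow> p \<in> words X \<Longrightarrow> q \<in> words X \<Longrightarrow>
    (p @ [(x, e), (x, \<not> e)] @ q, p @ q) \<in> word_cong X rels"
| relation: "(u, v) \<in> rels \<Longrightarrow> p \<in> words X \<Longrightarrow> q \<in> words X \<Longrightarrow>
    (p @ u @ q, p @ v @ q) \<in> word_cong X rels"
| refl: "w \<in> words X \<Longrightarrow> (w, w) \<in> word_cong X rels"
| sym: "(u, v) \<in> word_cong X rels \<Longrightarrow> (v, u) \<in> word_cong X rels"
| trans: "(u, v) \<in> word_cong X rels \<Longrightarrow> (v, w) \<in> word_cong X rels \<Longrightarrow> (u, w) \<in> word_cong X rels"

definition word_class :: "'g set \<Rightarrow> ('g word \<times> 'g word) set \<Rightarrow> 'g word \<Rightarrow> 'g word set" where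
  "word_class X rels w = word_cong X rels `` {w}"

definition presented_group :: "'g set \<Rightarrow> ('g word \<times> 'g word) set \<Rightarrow> 'g word set monoid" where
  "presented_group X rels =
    \<lparr>carrier = words X // word_cong X rels,
     mult = (\<lambda>A B. \<Union>u\<in>A. \<Union>v\<in>B. word_class X rels (u @ v)),
     one = word_class X rels []\<rparr>"

(* The first conjunct excludes ill-formed relations, for which word_cong would leave words X. *)
definition has_presentation ::
  "('b, 'm) monoid_scheme \<Rightarrow> ('g \<Rightarrow> 'b) \<Rightarrow> 'g set \<Rightarrow> ('g word \<times> 'g word) set \<Rightarrow> bool" where
  "has_presentation G f X rels \<longleftrightarrow>
    rels \<subseteq> words X \<times> words X \<and>
    (\<exists>\<phi>\<in>iso (presented_group X rels) G. \<forall>x\<in>X. \<phi> (word_class X rels [(x, True)]) = f x)"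

definition special_linear_group :: "('a::field ^ 'n ^ 'n) monoid" where
  "special_linear_group = \<lparr>carrier = {A. det A = 1}, mult = (**), one = mat 1\<rparr>"

definition units_group :: "'a::field monoid" where
  "units_group = \<lparr>carrier = UNIV - {0}, mult = (*), one = 1\<rparr>"

definition cubes :: "'a::field set" where
  "cubes = (\<lambda>x. x ^ 3) ` (UNIV - {0})"

definition cube_class_representatives :: "'a::field set \<Rightarrow> bool" where
  "cube_class_representatives A \<longleftrightarrow>
    A \<subseteq> UNIV - {0} \<and> (\<forall>C\<in>carrier (units_group Mod cubes). \<exists>!a. a \<in> A \<inter> C)"

datatype 'a sl3_gen = GenR 'a | GenS | GenJ | GenT

definition sl3_gens :: "'a::field sl3_gen set" where
  "sl3_gens = GenR ` (UNIV - {0, 1}) \<union> {GenS, GenJ, GenT}"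

fun sl3_matrix :: "'a::field sl3_gen \<Rightarrow> 'a ^ 3 ^ 3" where
  "sl3_matrix (GenR a) = vector [vector [a, 0, 0], vector [0, 1, 0], vector [0, 0, inverse a]]"
| "sl3_matrix GenS = vector [vector [-1, 1, 0], vector [0, 1, 0], vector [0, 0, -1]]"
| "sl3_matrix GenJ = vector [vector [0, -1, 0], vector [-1, 0, 0], vector [0, 0, -1]]"
| "sl3_matrix GenT = vector [vector [0, 0, -1], vector [0, -1, 0], vector [-1, 0, 0]]"

(* GenR 1 is not a generator: R(1) denotes the empty word. *)
definition wR :: "'a::field \<Rightarrow> 'a sl3_gen word" where
  "wR a = (if a = 1 then [] else [(GenR a, True)])"

definition wS :: "'a::field sl3_gen word" where "wS = [(GenS, True)]"
definition wJ :: "'a::field sl3_gen word" where "wJ = [(GenJ, True)]"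
definition wT :: "'a::field sl3_gen word" where "wT = [(GenT, True)]"

definition wZ :: "'a::field \<Rightarrow> 'a sl3_gen word" where
  "wZ a = wpow (wJ @ wR a) 2"

definition wE12 :: "'a::field \<Rightarrow> 'a sl3_gen word" where
  "wE12 a = wR a @ wS @ winv (wR (- a))"

definition wW :: "'a::field sl3_gen word" where
  "wW = wT @ wS @ wT"

definition wrho :: "'a::field \<Rightarrow> 'a sl3_gen word" where
  "wrho a = wE12 (- a) @ wJ @ wR a"

definition wlambda :: "'a::field \<Rightarrow> 'a sl3_gen word" where
  "wlambda a =
    wE12 (- inverse (a ^ 2)) @ wJ @ wE12 (a ^ 2) @ wpow (wR a) 4 @ winv (wpow (wZ a) 2)"

definition sl3_relations :: "'a::field set \<Rightarrow> ('a sl3_gen word \<times> 'a sl3_gen word) set" where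
  "sl3_relations reps =
     {(wpow wS 2, []), (wpow wJ 2, []), (wpow wT 2, [])}
   \<union> {(wR a @ wR b, wR (a * b)) | a b. a \<notin> {0, 1} \<and> b \<notin> {0, 1}}
   \<union> {(wZ a @ wZ b, wZ (a * b)) | a b. a \<notin> {0, 1} \<and> b \<notin> {0, 1}}
   \<union> {(wcomm (wR a) (wZ b), []) | a b. a \<notin> {0, 1} \<and> b \<notin> {0, 1}}
   \<union> {(wcomm wS (wZ a), []) | a. a \<notin> {0, 1}}
   \<union> {(wcomm wS (wR a), wE12 (1 - a)) | a. a \<notin> {0, 1}}
   \<union> {(wpow (wJ @ wS) 3, []), (wpow (wT @ wJ) 3, [])}
   \<union> {(wpow (wT @ wR a) 2, []) | a. a \<notin> {0, 1}}
   \<union> {(wcomm (wZ a) wT, wpow (wR a) 3) | a. a \<notin> {0, 1}}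
   \<union> {(wpow (wW @ wE12 a) 2, []) | a. a \<in> reps}
   \<union> {(wW @ wJ @ wR a @ wW, wrho a @ wW @ wlambda a) | a. a \<in> reps}"

end

theory Submission
  imports Defs
begin

text \<open>
  From the relations one builds the torus \<open>D x y = R(x/y) Z(y)\<close>, the Weyl group generated by
  \<open>J\<close> and \<open>T\<close>, and, by conjugating \<open>E\<^sub>1\<^sub>2\<close>, root elements for all six roots. Relation (vi) makes
  \<open>E\<^sub>1\<^sub>2\<close> additive. Pairs of root elements are scaled by the torus through characters whose product
  (or quotient) is a cube, so (x) and (xi), imposed only for representatives of
  \<open>K\<^sup>\<times>/(K\<^sup>\<times>)\<^sup>3\<close>, already give the commutator relations for all parameters. Hence every element of
  the presented group has a Bruhat form \<open>u D w u'\<close>, and such an element with trivial matrix is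
  trivial. Surjectivity is Gaussian elimination.

  The calculations take place in a type of class \<^class>\<open>monoid_mult\<close>, where simplification needs no
  carrier conditions. The presented group enters through its left regular representation, paired with
  the matrix.
\<close>

section \<open>Presented groups\<close>

lemma words_append [simp]: "u @ v \<in> words X \<longleftrightarrow> u \<in> words X \<and> v \<in> words X"
  by (auto simp: words_def)

lemma words_Nil [simp]: "[] \<in> words X"
  by (simp add: words_def)

lemma words_Cons [simp]: "(x, e) # w \<in> words X \<longleftrightarrow> x \<in> X \<and> w \<in> words X"
  by (auto simp: words_def)

lemma words_winv [simp]: "winv w \<in> words X \<longleftrightarrow> w \<in> words X"
  by (induction w) (auto simp: winv_def)

lemma words_wpow: "w \<in> words X \<Longrightarrow> wpow w n \<in> words X"
  by (induction n) (simp_all add: wpow_def)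

lemma winv_Nil: "winv [] = []"
  by (simp add: winv_def)

lemma winv_Cons: "winv ((x, e) # w) = winv w @ [(x, \<not> e)]"
  by (simp add: winv_def)

lemma word_cong_words:
  assumes "rels \<subseteq> words X \<times> words X" "(u, v) \<in> word_cong X rels"
  shows "u \<in> words X \<and> v \<in> words X"
  using assms(2) by induction (use assms(1) in auto)

lemma word_cong_append_left:
  assumes "(u, v) \<in> word_cong X rels" "p \<in> words X"
  shows "(p @ u, p @ v) \<in> word_cong X rels"
  using assms
proof (induction rule: word_cong.induct)
  case (cancel x p' q e)
  then show ?case using word_cong.cancel[of x X "p @ p'" q] by simp
next
  case (relation u v p' q)
  then show ?case using word_cong.relation[of u v rels "p @ p'" X q] by simp
next
  case (trans u v w)
  show ?case by (rule word_cong.trans[OF trans.IH]) fact+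
qed (simp_all add: word_cong.refl word_cong.sym)

lemma word_cong_append_right:
  assumes "(u, v) \<in> word_cong X rels" "q \<in> words X"
  shows "(u @ q, v @ q) \<in> word_cong X rels"
  using assms
proof (induction rule: word_cong.induct)
  case (cancel x p q' e)
  then show ?case using word_cong.cancel[of x X p "q' @ q"] by simp
next
  case (relation u v p q')
  then show ?case using word_cong.relation[of u v rels p X "q' @ q"] by simp
next
  case (trans u v w)
  show ?case by (rule word_cong.trans[OF trans.IH]) fact+
qed (simp_all add: word_cong.refl word_cong.sym)

lemma word_cong_winv_left:
  "w \<in> words X \<Longrightarrow> (winv w @ w, []) \<in> word_cong X rels"
proof (induction w)
  case (Cons l w)
  obtain x e where l: "l = (x, e)" by fastforce
  have "(winv w @ [(x, \<not> e), (x, e)] @ w, winv w @ w) \<in> word_cong X rels"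
    using word_cong.cancel[of x X "winv w" w "\<not> e"] Cons by (simp add: l)
  from word_cong.trans[OF this] Cons show ?case by (simp add: l winv_Cons)
qed (simp add: winv_Nil word_cong.refl)

section \<open>The group structure on congruence classes of words\<close>

locale presentation =
  fixes X :: "'g set" and rels :: "('g word \<times> 'g word) set"
  assumes rels_words: "rels \<subseteq> words X \<times> words X"
begin

abbreviation cls where "cls \<equiv> word_class X rels"
abbreviation P where "P \<equiv> presented_group X rels"

lemma word_cong_equiv: "equiv (words X) (word_cong X rels)"
proof (rule equivI)
  show "word_cong X rels \<subseteq> words X \<times> words X"
    using word_cong_words[OF rels_words] by auto
  show "refl_on (words X) (word_cong X rels)"
    by (auto simp: refl_on_def intro: word_cong.refl)
  show "sym (word_cong X rels)" by (auto intro: symI word_cong.sym)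
  show "trans (word_cong X rels)" by (rule transI) (rule word_cong.trans)
qed

lemma cls_eq_iff: "u \<in> words X \<Longrightarrow> v \<in> words X \<Longrightarrow> cls u = cls v \<longleftrightarrow> (u, v) \<in> word_cong X rels"
  unfolding word_class_def using eq_equiv_class_iff[OF word_cong_equiv] by blast

lemma carrier_P: "carrier P = cls ` words X"
  by (auto simp: presented_group_def quotient_def word_class_def)

text \<open>The congruence respects concatenation on both sides, so every class in the double union
  that defines the product is the same one.\<close>

lemma mult_P:
  assumes "u \<in> words X" "v \<in> words X"
  shows "cls u \<otimes>\<^bsub>P\<^esub> cls v = cls (u @ v)"
proof -
  have "cls (u' @ v') = cls (u @ v)" if "u' \<in> cls u" "v' \<in> cls v" for u' v'
  proof -
    have uv: "(u, u') \<in> word_cong X rels" "(v, v') \<in> word_cong X rels"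
      using that by (auto simp: word_class_def)
    then have w: "u' \<in> words X" "v' \<in> words X" using word_cong_words[OF rels_words] by blast+
    have "(u @ v, u' @ v') \<in> word_cong X rels"
      using word_cong_append_right[OF uv(1) assms(2)] word_cong_append_left[OF uv(2) w(1)]
      by (rule word_cong.trans)
    then show ?thesis using w assms by (simp add: cls_eq_iff[symmetric])
  qed
  moreover have "u \<in> cls u" "v \<in> cls v" using assms by (auto simp: word_class_def intro: word_cong.refl)
  ultimately have "(\<Union>u'\<in>cls u. \<Union>v'\<in>cls v. cls (u' @ v')) = cls (u @ v)" by blast
  then show ?thesis by (simp add: presented_group_def)
qed

lemma one_P: "\<one>\<^bsub>P\<^esub> = cls []"
  by (simp add: presented_group_def)

lemma group_P: "group P"
proof (rule groupI)
  fix A assume "A \<in> carrier P"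
  then obtain w where w: "w \<in> words X" "A = cls w" by (auto simp: carrier_P)
  then have "cls (winv w) \<otimes>\<^bsub>P\<^esub> A = \<one>\<^bsub>P\<^esub>"
    by (simp add: mult_P one_P cls_eq_iff word_cong_winv_left)
  then show "\<exists>B\<in>carrier P. B \<otimes>\<^bsub>P\<^esub> A = \<one>\<^bsub>P\<^esub>" using w by (auto simp: carrier_P)
qed (auto simp: carrier_P mult_P one_P)

end

section \<open>Evaluation of words in a group and a criterion for a presentation\<close>

definition word_eval :: "('b, 'm) monoid_scheme \<Rightarrow> ('g \<Rightarrow> 'b) \<Rightarrow> 'g word \<Rightarrow> 'b" where
  "word_eval G f w = foldr (\<lambda>(x, e) g. (if e then f x else inv\<^bsub>G\<^esub> f x) \<otimes>\<^bsub>G\<^esub> g) w \<one>\<^bsub>G\<^esub>"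

context group
begin

context
  fixes f :: "'g \<Rightarrow> 'a" and X :: "'g set"
  assumes f_closed: "x \<in> X \<Longrightarrow> f x \<in> carrier G"
begin

lemma word_eval_Nil: "word_eval G f [] = \<one>"
  by (simp add: word_eval_def)

lemma word_eval_Cons: "word_eval G f ((x, e) # w) = (if e then f x else inv f x) \<otimes> word_eval G f w"
  by (simp add: word_eval_def)

lemma word_eval_closed: "w \<in> words X \<Longrightarrow> word_eval G f w \<in> carrier G"
  using f_closed by (induction w) (auto simp: word_eval_Nil word_eval_Cons split: prod.splits)

lemma word_eval_append:
  "u \<in> words X \<Longrightarrow> v \<in> words X \<Longrightarrow> word_eval G f (u @ v) = word_eval G f u \<otimes> word_eval G f v"
proof (induction u)
  case (Cons l u)
  then show ?case using f_closed
    by (cases l) (auto simp: word_eval_Cons word_eval_closed m_assoc)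
qed (simp add: word_eval_Nil word_eval_closed)

lemma word_eval_cong:
  assumes "(u, v) \<in> word_cong X rels" "rels \<subseteq> words X \<times> words X"
    "\<And>u v. (u, v) \<in> rels \<Longrightarrow> word_eval G f u = word_eval G f v"
  shows "word_eval G f u = word_eval G f v"
  using assms(1)
proof induction
  case (cancel x p q e)
  have "f x \<in> carrier G" using f_closed cancel by simp
  then have "word_eval G f [(x, e), (x, \<not> e)] = \<one>"
    by (cases e) (simp_all add: word_eval_Cons word_eval_Nil)
  then have "word_eval G f ([(x, e), (x, \<not> e)] @ q) = word_eval G f q"
    using cancel word_eval_append[of "[(x, e), (x, \<not> e)]" q] by (simp add: word_eval_closed)
  then show ?case using cancel by (simp add: word_eval_append)
next
  case (relation u v p q)
  moreover have "u \<in> words X" "v \<in> words X" using relation assms(2) by auto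
  ultimately show ?case by (simp add: word_eval_append assms(3))
qed auto

lemma word_eval_winv:
  assumes "w \<in> words X" shows "word_eval G f (winv w) = inv (word_eval G f w)"
proof -
  have "word_eval G f (winv w) \<otimes> word_eval G f w = word_eval G f (winv w @ w)"
    using assms by (simp add: word_eval_append)
  \<comment> \<open>Free cancellation suffices here, hence the empty set of relations.\<close>
  also have "\<dots> = word_eval G f []"
    by (rule word_eval_cong[of _ _ "{}"]) (use assms word_cong_winv_left in auto)
  finally show ?thesis
    using assms by (intro inv_equality[symmetric]) (simp_all add: word_eval_Nil word_eval_closed)
qed

text \<open>Soundness makes evaluation well defined on classes. For injectivity it is enough to
  treat words with value one: if \<open>u\<close> and \<open>v\<close> have the same value,
  completeness applies to \<open>u @ winv v\<close>.\<close>

lemma has_presentationI: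
  assumes rels: "rels \<subseteq> words X \<times> words X"
    and sound: "\<And>u v. (u, v) \<in> rels \<Longrightarrow> word_eval G f u = word_eval G f v"
    and complete: "\<And>w. w \<in> words X \<Longrightarrow> word_eval G f w = \<one> \<Longrightarrow> (w, []) \<in> word_cong X rels"
    and surj: "carrier G \<subseteq> word_eval G f ` words X"
  shows "has_presentation G f X rels"
proof -
  interpret presentation X rels by unfold_locales (rule rels)
  define \<phi> where "\<phi> A = word_eval G f (SOME w. w \<in> words X \<and> cls w = A)" for A
  have \<phi>: "\<phi> (cls w) = word_eval G f w" if "w \<in> words X" for w
  proof -
    define v where "v = (SOME v. v \<in> words X \<and> cls v = cls w)"
    have v: "v \<in> words X \<and> cls v = cls w"
      unfolding v_def using that by (intro someI_ex[of "\<lambda>v. v \<in> words X \<and> cls v = cls w"]) auto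
    then have "(v, w) \<in> word_cong X rels" using that cls_eq_iff[of v w] by simp
    then have "word_eval G f v = word_eval G f w" by (rule word_eval_cong[OF _ rels sound])
    then show ?thesis by (simp add: \<phi>_def v_def)
  qed
  have cong: "(u, v) \<in> word_cong X rels"
    if "u \<in> words X" "v \<in> words X" "word_eval G f u = word_eval G f v" for u v
  proof -
    have "(u @ winv v, []) \<in> word_cong X rels"
      using that by (intro complete) (simp_all add: word_eval_append word_eval_winv word_eval_closed)
    then have "(u @ winv v @ v, v) \<in> word_cong X rels"
      using word_cong_append_right[OF _ that(2)] by fastforce
    moreover have "(u @ winv v @ v, u) \<in> word_cong X rels"
      using word_cong_append_left[OF word_cong_winv_left[OF that(2)] that(1)] by simp
    ultimately show ?thesis by (rule word_cong.trans[OF word_cong.sym, rotated])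
  qed
  have "\<phi> \<in> iso P G"
  proof (rule isoI)
    show "\<phi> \<in> hom P G"
      by (auto simp: hom_def carrier_P \<phi> mult_P word_eval_append word_eval_closed)
    show "bij_betw \<phi> (carrier P) (carrier G)"
      unfolding bij_betw_def
    proof
      show "inj_on \<phi> (carrier P)"
      proof (rule inj_onI)
        fix A B assume "A \<in> carrier P" "B \<in> carrier P" "\<phi> A = \<phi> B"
        then obtain u v where uv: "u \<in> words X" "A = cls u" "v \<in> words X" "B = cls v"
          by (auto simp: carrier_P)
        with \<open>\<phi> A = \<phi> B\<close> have "(u, v) \<in> word_cong X rels" by (intro cong) (simp_all add: \<phi>)
        with uv show "A = B" by (simp add: cls_eq_iff)
      qed
      show "\<phi> ` carrier P = carrier G"
        using surj by (auto simp: carrier_P image_image \<phi> word_eval_closed)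
    qed
  qed
  moreover have "\<phi> (cls [(x, True)]) = f x" if "x \<in> X" for x
    using that f_closed by (auto simp: \<phi> word_eval_Cons word_eval_Nil)
  ultimately show ?thesis unfolding has_presentation_def using rels by blast
qed

end

end

section \<open>Consequences of the relations\<close>

text \<open>Products are normalised to nest to the right, where a rule for \<open>x * y\<close> no
  longer matches once another factor follows. This adapts such a rule.\<close>

lemma mult_extend:
  fixes x :: "'m::semigroup_mult"
  shows "x * y = z \<Longrightarrow> x * (y * w) = z * w"
  by (simp add: mult.assoc[symmetric])

lemma mult_right_cancel_monoid:
  fixes x :: "'m::monoid_mult"
  assumes "x * x' = 1" "y * x = z * x"
  shows "y = z"
  by (metis assms mult.assoc mult_1_right)

locale sl3_relators =
  fixes R :: "'a::field \<Rightarrow> 'm::monoid_mult" and S J T :: 'm and reps :: "'a set"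
  assumes R_1: "R 1 = 1"
    and R_mult: "a \<noteq> 0 \<Longrightarrow> b \<noteq> 0 \<Longrightarrow> R a * R b = R (a * b)"
    and SS: "S * S = 1" and JJ: "J * J = 1" and TT: "T * T = 1"
    and JR_square_mult: "a \<noteq> 0 \<Longrightarrow> b \<noteq> 0 \<Longrightarrow> (J * R a)^2 * (J * R b)^2 = (J * R (a * b))^2"
    and R_JR_square: "a \<noteq> 0 \<Longrightarrow> b \<noteq> 0 \<Longrightarrow> R a * (J * R b)^2 = (J * R b)^2 * R a"
    and S_JR_square: "a \<noteq> 0 \<Longrightarrow> S * (J * R a)^2 = (J * R a)^2 * S"
    and S_R_commutator: "a \<noteq> 0 \<Longrightarrow> a \<noteq> 1 \<Longrightarrow>
      S * R a * S * R (inverse a) = R (1 - a) * S * R (- inverse (1 - a))"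
    and JS_braid: "J * S * J = S * J * S"
    and TJ_braid: "T * J * T = J * T * J"
    and T_R: "a \<noteq> 0 \<Longrightarrow> T * R a = R (inverse a) * T"
    and T_JR_square: "a \<noteq> 0 \<Longrightarrow> T * (J * R a)^2 = (J * R a)^2 * R (inverse (a^3)) * T"
    and commute_rel: "a \<in> reps \<Longrightarrow>
      (T * S * T * (R a * S * R (- inverse a)))^2 = 1"
    and bruhat_rel: "a \<in> reps \<Longrightarrow>
      T * S * T * J * R a * (T * S * T) =
      R (-a) * S * R (inverse a) * J * R a * (T * S * T) *
      (R (- inverse (a^2)) * S * R (a^2) * J * (R (a^2) * S * R (- inverse (a^2))) * R a ^ 4
       * (J * R (inverse a))^4)"
    and reps_nonzero: "0 \<notin> reps"
    and reps_cubes: "c \<noteq> 0 \<Longrightarrow> \<exists>a\<in>reps. \<exists>k. k \<noteq> 0 \<and> a = c * k^3"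
begin

section \<open>The torus and its conjugation by \<open>J\<close> and \<open>T\<close>\<close>

definition Z where "Z a = (J * R a)^2"
text \<open>In matrices this is the diagonal matrix with entries \<open>x\<close>, \<open>y\<close>,
  \<open>inverse (x * y)\<close>: the factor \<open>R (x / y)\<close> has entries
  \<open>x / y\<close>, 1, \<open>y / x\<close>, and \<open>Z y\<close> has entries
  \<open>y\<close>, \<open>y\<close>, \<open>inverse (y^2)\<close>.\<close>

definition D where "D x y = R (x / y) * Z y"

lemma Z_alt: "Z a = J * (R a * (J * R a))"
  by (simp add: Z_def power2_eq_square mult.assoc)

lemma JJ': "J * (J * w) = w" and TT': "T * (T * w) = w"
  by (simp_all add: mult.assoc[symmetric] JJ TT)

lemma R_inverse: "a \<noteq> 0 \<Longrightarrow> R a * R (inverse a) = 1" "a \<noteq> 0 \<Longrightarrow> R (inverse a) * R a = 1"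
  by (simp_all add: R_mult R_1)

lemma Z_1: "Z 1 = 1" by (simp add: Z_alt R_1 JJ)

lemma Z_mult: "a \<noteq> 0 \<Longrightarrow> b \<noteq> 0 \<Longrightarrow> Z a * Z b = Z (a * b)"
  by (simp add: Z_def JR_square_mult)

lemma R_Z: "a \<noteq> 0 \<Longrightarrow> b \<noteq> 0 \<Longrightarrow> R a * Z b = Z b * R a"
  by (simp add: Z_def R_JR_square)

lemma J_R: assumes "a \<noteq> 0" shows "J * R a = Z a * R (inverse a) * J"
proof -
  have "Z a * R (inverse a) * J = J * R a * J * (R a * R (inverse a)) * J"
    by (simp add: Z_alt mult.assoc)
  then show ?thesis using assms by (simp add: R_inverse mult.assoc JJ)
qed

lemma J_Z: assumes "a \<noteq> 0" shows "J * Z a = Z a * J"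
proof -
  have "J * Z a = R a * (J * R a)" by (simp add: Z_alt JJ')
  also have "\<dots> = R a * Z a * R (inverse a) * J" using J_R[OF assms] by (simp add: mult.assoc)
  also have "\<dots> = Z a * (R a * R (inverse a)) * J" using R_Z[OF assms assms] by (simp add: mult.assoc)
  finally show ?thesis using assms by (simp add: R_inverse)
qed

lemma R_as_D: "R a = D a 1" by (simp add: D_def Z_1)

lemma Z_as_D: "a \<noteq> 0 \<Longrightarrow> Z a = D a a" by (simp add: D_def R_1)

lemma D_1: "D 1 1 = 1" by (simp add: D_def Z_1 R_1)

lemma D_mult:
  assumes "x \<noteq> 0" "y \<noteq> 0" "x' \<noteq> 0" "y' \<noteq> 0"
  shows "D x y * D x' y' = D (x * x') (y * y')"
proof -
  have "D x y * D x' y' = R (x / y) * (Z y * R (x' / y')) * Z y'"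
    by (simp add: D_def mult.assoc)
  also have "\<dots> = (R (x / y) * R (x' / y')) * (Z y * Z y')"
    using assms by (simp add: R_Z[symmetric] mult.assoc)
  finally show ?thesis using assms by (simp add: R_mult Z_mult D_def)
qed

lemma J_D:
  assumes "x \<noteq> 0" "y \<noteq> 0" shows "J * D x y = D y x * J"
proof -
  have "J * D x y = Z (x / y) * R (y / x) * (J * Z y)"
    using assms by (simp add: D_def J_R mult.assoc[symmetric])
  also have "\<dots> = Z (x / y) * (R (y / x) * Z y) * J"
    using assms by (simp add: J_Z mult.assoc)
  also have "\<dots> = (Z (x / y) * Z y) * R (y / x) * J"
    using assms by (simp add: R_Z mult.assoc)
  also have "\<dots> = R (y / x) * Z x * J"
    using assms by (simp add: R_Z Z_mult)
  finally show ?thesis by (simp add: D_def)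
qed

text \<open>Conjugation by \<open>T\<close> exchanges the outer diagonal entries, the third one
  being \<open>inverse (x * y)\<close>. The cube in \<open>T_JR_square\<close> is the ratio of the
  outer entries of \<open>Z y\<close>.\<close>

lemma T_D:
  assumes "x \<noteq> 0" "y \<noteq> 0" shows "T * D x y = D (inverse (x * y)) y * T"
proof -
  have "T * D x y = R (y / x) * (T * Z y)"
    using assms by (simp add: D_def T_R mult.assoc[symmetric])
  also have "\<dots> = R (y / x) * (Z y * R (inverse (y^3))) * T"
    using assms by (simp add: Z_def T_JR_square mult.assoc)
  also have "\<dots> = (R (y / x) * R (inverse (y^3))) * Z y * T"
    using assms by (simp add: R_Z[symmetric] mult.assoc)
  also have "R (y / x) * R (inverse (y^3)) = R (inverse (x * y) / y)"
    using assms by (simp add: R_mult field_simps power3_eq_cube)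
  finally show ?thesis by (simp add: D_def)
qed

section \<open>Root elements for the six roots\<close>

definition e12 where "e12 a = (if a = 0 then 1 else R a * S * R (- inverse a))"
text \<open>The matrices of \<open>J\<close> and \<open>T\<close> are negatives of the permutation
  matrices of (1 2) and (1 3), so conjugation by them permutes the indices of an elementary matrix
  without changing the sign of its parameter.\<close>

definition e21 where "e21 a = J * e12 a * J"
definition e32 where "e32 a = T * e12 a * T"
definition e31 where "e31 a = J * e32 a * J"
definition e23 where "e23 a = T * e21 a * T"
definition e13 where "e13 a = J * e23 a * J"

text \<open>The value at 0 is set apart because the relations say nothing about \<open>R 0\<close>;
  with this value \<open>e12\<close> becomes additive on the whole field.\<close>

lemma e12_0: "e12 0 = 1" by (simp add: e12_def)

lemma S_Z: "a \<noteq> 0 \<Longrightarrow> S * Z a = Z a * S" by (simp add: Z_def S_JR_square)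

lemma R_e12:
  assumes "c \<noteq> 0" shows "R c * e12 a = e12 (c * a) * R c"
proof (cases "a = 0")
  case False
  have "e12 (c * a) * R c = R (c * a) * S * (R (- inverse (c * a)) * R c)"
    using False assms by (simp add: e12_def mult.assoc)
  also have "R (- inverse (c * a)) * R c = R (- inverse a)"
    using False assms by (simp add: R_mult field_simps)
  also have "R (c * a) * S * R (- inverse a) = (R c * R a) * S * R (- inverse a)"
    using False assms by (simp add: R_mult)
  finally show ?thesis using False by (simp add: e12_def mult.assoc)
qed (simp add: e12_0)

lemma Z_e12:
  assumes "c \<noteq> 0" shows "Z c * e12 a = e12 a * Z c"
proof (cases "a = 0")
  case False
  have "Z c * e12 a = (Z c * R a) * S * R (- inverse a)"
    using False by (simp add: e12_def mult.assoc)
  also have "\<dots> = R a * (Z c * S) * R (- inverse a)"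
    using False assms by (simp add: R_Z mult.assoc[symmetric])
  also have "\<dots> = R a * S * (Z c * R (- inverse a))"
    using assms by (simp add: S_Z[symmetric] mult.assoc)
  also have "\<dots> = e12 a * Z c"
    using False assms by (simp add: R_Z[symmetric] mult.assoc e12_def)
  finally show ?thesis .
qed (simp add: e12_0)

lemma D_e12:
  assumes "x \<noteq> 0" "y \<noteq> 0" shows "D x y * e12 a = e12 (a * x / y) * D x y"
proof -
  have "D x y * e12 a = R (x / y) * e12 a * Z y"
    using assms by (simp add: D_def Z_e12 mult.assoc)
  then show ?thesis using assms by (simp add: R_e12 D_def mult.assoc mult.commute)
qed

text \<open>Splitting \<open>S\<close> into a unipotent and a torus part turns each relation for
  \<open>S\<close> into one for \<open>e12\<close>.\<close>

lemma S_as_e12: "S = e12 1 * D (-1) 1"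
  by (simp add: e12_def R_as_D[symmetric] R_1 mult.assoc R_mult)

lemma e12_1_neg: "e12 1 * e12 (-1) = 1"
proof -
  have "S * S = e12 1 * (R (-1) * e12 1) * R (-1)"
    by (subst (1 2) S_as_e12) (simp add: R_as_D mult.assoc)
  also have "\<dots> = e12 1 * e12 (-1) * (R (-1) * R (-1))"
    by (simp add: R_e12 mult.assoc)
  finally show ?thesis by (simp add: R_mult R_1 SS)
qed

text \<open>This is \<open>S_R_commutator\<close> at \<open>- a\<close> with both factors
  \<open>S\<close> split. It does not cover the values 0 and -1 of \<open>a\<close>; the latter
  comes from \<open>S * S = 1\<close>.\<close>

lemma e12_1_add: "e12 1 * e12 a = e12 (1 + a)"
proof -
  consider "a = 0" | "a = -1" | "a \<noteq> 0" "a \<noteq> -1" by blast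
  then show ?thesis
  proof cases
    case 3
    define c where "c = - a"
    have c: "c \<noteq> 0" "c \<noteq> 1" using 3 by (auto simp: c_def minus_equation_iff)
    have "e12 (1 - c) = S * R c * S * R (inverse c)"
      using c S_R_commutator[OF c] by (simp add: e12_def)
    also have "\<dots> = e12 1 * (R (-1) * R c * e12 1) * R (-1) * R (inverse c)"
      by (subst (1 2) S_as_e12) (simp add: R_as_D mult.assoc)
    also have "\<dots> = e12 1 * e12 (- c) * (R (- c) * R (-1) * R (inverse c))"
      using c by (simp add: R_e12 R_mult mult.assoc)
    also have "\<dots> = e12 1 * e12 (- c)"
      using c by (simp add: R_mult R_1)
    finally show ?thesis by (simp add: c_def)
  qed (simp_all add: e12_0 e12_1_neg)
qed

text \<open>Conjugation by \<open>R a\<close> scales both parameters by \<open>a\<close>, which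
  reduces the claim to a first summand 1.\<close>

lemma e12_add: "e12 a * e12 b = e12 (a + b)"
proof (cases "a = 0")
  case False
  have "e12 a * e12 b * R a = (e12 a * R a) * e12 (b / a)"
    using False R_e12[of a "b / a"] by (simp add: mult.assoc)
  also have "\<dots> = R a * (e12 1 * e12 (b / a))"
    using False R_e12[of a 1] by (simp add: mult.assoc[symmetric])
  also have "\<dots> = e12 (a + b) * R a"
    using False R_e12[of a "1 + b / a"] by (simp add: e12_1_add distrib_left)
  finally show ?thesis using R_inverse(1)[OF False] mult_right_cancel_monoid by blast
qed (simp add: e12_0)

text \<open>The braid relation of \<open>J\<close> and \<open>S\<close>, with each \<open>S\<close>
  split, is the rank one Bruhat decomposition of a lower unitriangular element.\<close>

lemma e21_1_bruhat: "e21 1 = e12 1 * J * D (-1) 1 * e12 1"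
proof -
  have [simp]: "D (-1) 1 * D (-1) 1 = 1" by (simp add: D_mult D_1)
  have "J * (e12 1 * D (-1) 1) * J = e12 1 * D (-1) 1 * J * (e12 1 * D (-1) 1)"
    unfolding S_as_e12[symmetric] by (rule JS_braid)
  then have "e21 1 * (J * D (-1) 1 * J) = e12 1 * D (-1) 1 * J * e12 1 * D (-1) 1"
    by (simp add: e21_def mult.assoc JJ')
  then have *: "e21 1 * D 1 (-1) = e12 1 * D (-1) 1 * J * e12 1 * D (-1) 1"
    by (simp add: J_D mult.assoc JJ)
  have "e21 1 = e21 1 * (D 1 (-1) * D 1 (-1))" by (simp add: D_mult D_1)
  also have "\<dots> = e12 1 * (D (-1) 1 * J) * e12 1 * (D (-1) 1 * D 1 (-1))"
    using * by (simp add: mult.assoc[symmetric])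
  also have "\<dots> = e12 1 * J * D 1 (-1) * e12 1 * (D (-1) 1 * D 1 (-1))"
    by (simp add: J_D mult.assoc)
  \<comment> \<open>The element \<open>D (-1) (-1)\<close> commutes with \<open>e12 1\<close>,
    because its first two entries agree.\<close>
  also have "\<dots> = e12 1 * J * (D 1 (-1) * D (-1) (-1)) * e12 1"
    using D_e12[of "-1" "-1" 1, symmetric]
    by (simp add: D_mult D_mult[THEN mult_extend] mult.assoc)
  finally show ?thesis by (simp add: D_mult)
qed


lemmas JT_cancel = JJ TT JJ' TT'

lemma J_e:
  "J * e12 a = e21 a * J" "J * e21 a = e12 a * J" "J * e13 a = e23 a * J"
  "J * e23 a = e13 a * J" "J * e31 a = e32 a * J" "J * e32 a = e31 a * J"
  by (simp_all add: e21_def e13_def e31_def mult.assoc JT_cancel)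

text \<open>Only \<open>e13\<close> and \<open>e31\<close> require the braid relation of
  \<open>T\<close> and \<open>J\<close>; the other identities follow from the definitions and
  \<open>T * T = 1\<close>.\<close>

lemma T_e:
  "T * e12 a = e32 a * T" "T * e32 a = e12 a * T" "T * e13 a = e31 a * T"
  "T * e31 a = e13 a * T" "T * e21 a = e23 a * T" "T * e23 a = e21 a * T"
proof -
  show *: "T * e13 a = e31 a * T" for a
  proof -
    have TJTJ: "T * (J * (T * (J * w))) = J * (T * w)" for w
      using arg_cong[OF TJ_braid, of "\<lambda>x. x * (J * w)"] by (simp add: mult.assoc JT_cancel)
    have "T * e13 a = T * (J * (T * (J * (e12 a * (J * (T * J))))))"
      by (simp add: e13_def e23_def e21_def mult.assoc)
    also have "\<dots> = J * (T * (e12 a * (T * (J * T))))"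
      using TJ_braid by (simp add: TJTJ mult.assoc)
    finally show ?thesis by (simp add: e31_def e32_def mult.assoc)
  qed
  have "T * e31 a = T * (e31 a * T) * T" by (simp add: mult.assoc TT)
  also have "\<dots> = e13 a * T" by (simp add: *[symmetric] mult.assoc[symmetric] TT)
  finally show "T * e31 a = e13 a * T" .
qed (simp_all add: e32_def e23_def mult.assoc JT_cancel)

lemmas JT_e = J_e T_e J_e[THEN mult_extend] T_e[THEN mult_extend]

lemma e_add:
  "e12 a * e12 b = e12 (a + b)" "e21 a * e21 b = e21 (a + b)" "e13 a * e13 b = e13 (a + b)"
  "e23 a * e23 b = e23 (a + b)" "e31 a * e31 b = e31 (a + b)" "e32 a * e32 b = e32 (a + b)"
proof -
  note add' = e12_add[THEN mult_extend]
  show 21: "e21 a * e21 b = e21 (a + b)" for a b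
    by (simp add: e21_def mult.assoc JT_cancel add')
  show 32: "e32 a * e32 b = e32 (a + b)" for a b
    by (simp add: e32_def mult.assoc JT_cancel add')
  show "e31 a * e31 b = e31 (a + b)"
    by (simp add: e31_def mult.assoc JT_cancel 32[THEN mult_extend])
  show 23: "e23 a * e23 b = e23 (a + b)" for a b
    by (simp add: e23_def mult.assoc JT_cancel 21[THEN mult_extend])
  show "e13 a * e13 b = e13 (a + b)"
    by (simp add: e13_def mult.assoc JT_cancel 23[THEN mult_extend])
qed (rule e12_add)

lemmas e_add' = e_add e_add[THEN mult_extend]

lemma e_0: "e12 0 = 1" "e21 0 = 1" "e13 0 = 1" "e23 0 = 1" "e31 0 = 1" "e32 0 = 1"
  by (simp_all add: e12_0 e21_def e13_def e31_def e23_def e32_def JT_cancel)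

lemmas JT_D = J_D T_D J_D[THEN mult_extend] T_D[THEN mult_extend]

text \<open>The scaling factors are the roots as characters of the torus: for indices i, j the
  factor is the quotient of the i-th by the j-th diagonal entry of \<open>D x y\<close>.\<close>

lemma D_e:
  assumes "x \<noteq> 0" "y \<noteq> 0"
  shows "D x y * e12 a = e12 (a * x / y) * D x y"
    "D x y * e21 a = e21 (a * y / x) * D x y"
    "D x y * e13 a = e13 (a * x^2 * y) * D x y"
    "D x y * e23 a = e23 (a * x * y^2) * D x y"
    "D x y * e31 a = e31 (a / (x^2 * y)) * D x y"
    "D x y * e32 a = e32 (a / (x * y^2)) * D x y"
proof -
  have D_J: "D x y * (J * w) = J * (D y x * w)" if "x \<noteq> 0" "y \<noteq> 0" for x y w
    using that by (simp add: J_D[THEN mult_extend] mult.assoc)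
  have D_T: "D x y * (T * w) = T * (D (inverse (x * y)) y * w)" if "x \<noteq> 0" "y \<noteq> 0" for x y w
    using that by (simp add: T_D[THEN mult_extend] mult.assoc)
  note D_12 = D_e12[THEN mult_extend]
  have D_21: "D x y * e21 a = e21 (a * y / x) * D x y" if "x \<noteq> 0" "y \<noteq> 0" for x y a
    using that by (simp add: e21_def mult.assoc D_J D_12 J_D)
  have D_32: "D x y * e32 a = e32 (a / (x * y^2)) * D x y" if "x \<noteq> 0" "y \<noteq> 0" for x y a
    using that by (simp add: e32_def mult.assoc D_T D_12 T_D) (simp add: field_simps power2_eq_square)
  show "D x y * e31 a = e31 (a / (x^2 * y)) * D x y"
    using assms by (simp add: e31_def mult.assoc D_J D_32[THEN mult_extend] J_D)
      (simp add: mult.commute)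
  have D_23: "D x y * e23 a = e23 (a * x * y^2) * D x y" if "x \<noteq> 0" "y \<noteq> 0" for x y a
    using that by (simp add: e23_def mult.assoc D_T D_21[THEN mult_extend] T_D)
      (simp add: field_simps power2_eq_square)
  show "D x y * e13 a = e13 (a * x^2 * y) * D x y"
    using assms by (simp add: e13_def mult.assoc D_J D_23[THEN mult_extend] J_D)
      (simp add: mult_ac)
  show "D x y * e12 a = e12 (a * x / y) * D x y" "D x y * e21 a = e21 (a * y / x) * D x y"
    "D x y * e32 a = e32 (a / (x * y^2)) * D x y" "D x y * e23 a = e23 (a * x * y^2) * D x y"
    using assms by (rule D_e12 D_21 D_32 D_23)+
qed

lemmas D_rules = D_e D_e[THEN mult_extend] D_mult D_mult[THEN mult_extend]

text \<open>Conjugation by \<open>D (inverse b) 1\<close> scales \<open>e21 1\<close> to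
  \<open>e21 b\<close>, so the decomposition at 1 gives all others.\<close>

lemma e21_bruhat:
  assumes "b \<noteq> 0"
  shows "e21 b = e12 (inverse b) * (D (inverse b) (- b) * (J * e12 (inverse b)))"
proof -
  have "e21 b = D (inverse b) 1 * e21 1 * D b 1"
    using assms by (simp add: D_rules mult.assoc D_1) (simp add: field_simps)
  also have "\<dots> = D (inverse b) 1 * (e12 1 * J * D (-1) 1 * e12 1) * D b 1"
    by (simp only: e21_1_bruhat)
  also have "\<dots> = e12 (inverse b) * (D (inverse b) (- b) * (J * e12 (inverse b)))"
    using assms by (simp add: D_rules JT_D JT_e mult.assoc)
  finally show ?thesis .
qed

definition W where "W = T * S * T"

lemma W_alt: "W = e32 1 * D (-1) 1"
proof -
  have "W = T * (e12 1 * D (-1) 1) * T" by (simp add: W_def S_as_e12[symmetric])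
  then show ?thesis by (simp add: JT_e JT_D JT_cancel mult.assoc)
qed

text \<open>Once \<open>W\<close> is written by \<open>W_alt\<close>, its two torus parts cancel and
  only flip signs, so \<open>commute_rel\<close> says that a commutator of root elements is
  trivial.\<close>

lemma e32_e12_reps:
  assumes "a \<in> reps" shows "e32 1 * e12 (- a) = e12 (- a) * e32 1"
proof -
  have a: "a \<noteq> 0" using assms reps_nonzero by auto
  have "W * e12 a * (W * e12 a) = 1"
    using commute_rel[OF assms] a by (simp add: W_def e12_def power2_eq_square)
  then have *: "e32 1 * (e12 (- a) * (e32 (-1) * e12 a)) = 1"
    by (simp add: W_alt mult.assoc D_rules D_1)
  have "e32 1 * e12 (- a) = e32 1 * (e12 (- a) * (e32 (-1) * e12 a)) * (e12 (- a) * e32 1)"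
    by (simp add: mult.assoc e_add' e_0)
  with * show ?thesis by simp
qed

lemma cube_root_reps:
  assumes "c \<noteq> 0"
  obtains a k where "a \<in> reps" "a \<noteq> 0" "k \<noteq> 0" "a = c * k^3"
  using reps_cubes[OF assms] reps_nonzero by metis

text \<open>The torus scales the two parameters by characters with product \<open>1 / y^3\<close>.
  Hence it can carry the pair \<open>- a\<close>, 1 to \<open>u\<close>, \<open>v\<close> once
  \<open>a\<close> and \<open>u * v\<close> agree modulo cubes.\<close>

lemma e12_e32: "e12 u * e32 v = e32 v * e12 u"
proof (cases "u = 0 \<or> v = 0")
  case False
  then have "u * v \<noteq> 0" by simp
  then obtain a k where a: "a \<in> reps" "a \<noteq> 0" "k \<noteq> 0" "a = u * v * k^3"
    by (rule cube_root_reps)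
  \<comment> \<open>These solve \<open>- (a * x / y) = u\<close> and
    \<open>1 / (x * y^2) = v\<close>, given \<open>a = u * v * k^3\<close>.\<close>
  define x y where "x = u * k / a" and "y = - k"
  have xy: "x \<noteq> 0" "y \<noteq> 0" using a False by (auto simp: x_def y_def)
  have [simp]: "- (a * x / y) = u" "1 / (x * y^2) = v"
    using a False by (auto simp: x_def y_def field_simps power2_eq_square power3_eq_cube)
  have "D x y * (e32 1 * e12 (- a)) = e32 v * (e12 u * D x y)"
    using xy by (simp add: D_rules mult.assoc)
  moreover have "D x y * (e12 (- a) * e32 1) = e12 u * (e32 v * D x y)"
    using xy by (simp add: D_rules mult.assoc)
  ultimately have "e32 v * e12 u * D x y = e12 u * e32 v * D x y"
    using e32_e12_reps[OF a(1)] by (simp add: mult.assoc)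
  moreover have "D x y * D (inverse x) (inverse y) = 1" using xy by (simp add: D_mult D_1)
  ultimately show ?thesis by (metis mult_right_cancel_monoid)
qed (auto simp: e_0)

text \<open>Both sides of \<open>bruhat_rel\<close> are rewritten with root elements on the left.
  One \<open>e21\<close> remains on the right-hand side; opening it by \<open>e21_bruhat\<close>
  produces the same tail of torus and Weyl elements on both sides, which cancels.\<close>

lemma e12_e31_reps:
  assumes "a \<in> reps"
  shows "e12 (- a) * (e31 (inverse a) * e12 a) = e32 1 * e31 (inverse a)"
proof -
  have a: "a \<noteq> 0" using assms reps_nonzero by auto
  have Z: "(J * R (inverse a)) ^ 4 = D (inverse (a^2)) (inverse (a^2))"
  proof -
    have "(J * R (inverse a)) ^ 4 = Z (inverse a) * Z (inverse a)"
      unfolding Z_def power_add[symmetric] by simp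
    then show ?thesis using a by (simp add: Z_as_D D_mult power2_eq_square)
  qed
  have R4: "R a ^ 4 = D (a^4) 1"
    using a by (simp add: R_as_D D_mult mult.assoc numeral_eq_Suc)
  have "W * J * R a * W = e12 (- a) * J * R a * W * (e12 (- inverse (a^2)) * J * e12 (a^2)
      * D (a^4) 1 * D (inverse (a^2)) (inverse (a^2)))"
    using bruhat_rel[OF assms] a by (simp add: W_def e12_def R4 Z mult.assoc)

  moreover have "inverse (a^2) * a = inverse a" "a^2 / a = a" "a^4 * inverse (a^2) = a^2"
    "a * inverse (a^2) = inverse a" "1 / a = inverse a"
    using a by (simp_all add: field_simps power2_eq_square numeral_eq_Suc)
  ultimately have "e32 1 * (e31 (inverse a) * (D (-1) (- a) * J)) =
      e12 (- a) * (e31 (inverse a) * (e21 (inverse a) * (e12 (- a) * D (a^2) (- inverse a))))"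
    using a by (simp add: W_alt R_as_D D_rules JT_D JT_e JT_cancel mult.assoc)
  \<comment> \<open>The last factor \<open>e12 a\<close> in the decomposition of
    \<open>e21 (inverse a)\<close> cancels against \<open>e12 (- a)\<close>.\<close>
  also have "\<dots> = e12 (- a) * (e31 (inverse a) * (e12 a * (D a (- inverse a) * (J * D (a^2) (- inverse a)))))"
    using a e21_bruhat[of "inverse a"] by (simp add: mult.assoc e_add' e_0)
  also have "\<dots> = e12 (- a) * (e31 (inverse a) * (e12 a * (D (-1) (- a) * J)))"
  proof -
    have "inverse a * a^2 = a" using a by (simp add: power2_eq_square)
    then show ?thesis using a by (simp add: JT_D D_rules)
  qed
  finally have "e32 1 * e31 (inverse a) * (D (-1) (- a) * J) =
      e12 (- a) * (e31 (inverse a) * e12 a) * (D (-1) (- a) * J)"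
    by (simp add: mult.assoc)
  moreover have "D (-1) (- a) * J * (J * D (-1) (- inverse a)) = 1"
    using a by (simp add: JT_cancel D_rules D_1 mult.assoc)
  ultimately show ?thesis by (metis mult_right_cancel_monoid)
qed

text \<open>The torus again carries the known case to all parameters; here the quantity preserved
  modulo cubes is \<open>u^2 * v\<close>.\<close>

lemma e31_e12: "e31 v * e12 u = e12 u * (e32 (u * v) * e31 v)"
proof (cases "u = 0 \<or> v = 0")
  case False
  then have "u^2 * v \<noteq> 0" by simp
  then obtain a k where a: "a \<in> reps" "a \<noteq> 0" "k \<noteq> 0" "a = u^2 * v * k^3"
    by (rule cube_root_reps)
  \<comment> \<open>This choice solves \<open>a * x / k = u\<close>; the factors for
    \<open>e31\<close> and \<open>e32\<close> then come out right because
    \<open>a = u^2 * v * k^3\<close>.\<close>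
  define x where "x = u * k / a"
  have x: "x \<noteq> 0" using a False by (auto simp: x_def)
  have "a * x / k = u" "1 / (x * k^2) = u * v" "inverse a / (x^2 * k) = v"
    using a False by (auto simp: x_def field_simps power2_eq_square power3_eq_cube)
  then have *: "D x k * e12 (- a) = e12 (- u) * D x k" "D x k * e12 a = e12 u * D x k"
    "D x k * e32 1 = e32 (u * v) * D x k" "D x k * e31 (inverse a) = e31 v * D x k"
    using x a(3) by (simp_all add: D_e)
  have "e12 (- u) * (e31 v * (e12 u * D x k)) = D x k * (e12 (- a) * (e31 (inverse a) * e12 a))"
    by (simp add: * *[THEN mult_extend] mult.assoc)
  also have "\<dots> = e32 (u * v) * (e31 v * D x k)"
    by (simp add: e12_e31_reps[OF a(1)] * *[THEN mult_extend] mult.assoc)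
  finally have "e12 (- u) * (e31 v * e12 u) * D x k = e32 (u * v) * e31 v * D x k"
    by (simp add: mult.assoc)
  moreover have "D x k * D (inverse x) (inverse k) = 1" using x a(3) by (simp add: D_mult D_1)
  ultimately have "e12 (- u) * (e31 v * e12 u) = e32 (u * v) * e31 v"
    by (metis mult_right_cancel_monoid)
  then have "e12 u * (e12 (- u) * (e31 v * e12 u)) = e12 u * (e32 (u * v) * e31 v)" by simp
  then show ?thesis by (simp add: e_add' e_0)
qed (auto simp: e_0)

text \<open>Since \<^term>\<open>e31\<close> is additive, moving \<^term>\<open>e12 1\<close> past \<^term>\<open>e31 (v + u)\<close> in one step or in
  two gives the same result, which forces the two row elements to commute.\<close>

lemma e31_e32: "e31 v * e32 u = e32 u * e31 v"
proof -
  have "e12 1 * (e32 (u + v) * e31 (u + v)) = e31 (v + u) * e12 1"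
    by (simp add: e31_e12 add.commute)
  also have "\<dots> = e31 v * (e31 u * e12 1)"
    by (simp add: e_add' mult.assoc[symmetric])
  also have "\<dots> = (e31 v * e12 1) * (e32 u * e31 u)"
    by (simp add: e31_e12[of u] mult.assoc)
  also have "\<dots> = e12 1 * (e32 v * (e31 v * (e32 u * e31 u)))"
    by (simp add: e31_e12 mult.assoc)
  finally have "e12 1 * (e32 (u + v) * e31 (u + v)) = e12 1 * (e32 v * (e31 v * (e32 u * e31 u)))" .
  from arg_cong[OF this, of "\<lambda>x. e32 (- v) * (e12 (-1) * (x * e31 (- u)))"]
  show ?thesis by (simp add: e_add' e_0 mult.assoc)
qed

lemma JT_braid: "T * (J * T) = J * (T * J)"
  using TJ_braid by (simp add: mult.assoc)

lemma JT_braid': "T * (J * (T * w)) = J * (T * (J * w))"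
  using arg_cong[OF JT_braid, of "\<lambda>x. x * w"] by (simp add: mult.assoc)

lemmas JT_rules = JT_cancel JT_braid JT_braid' JT_e JT_D

lemma transport:
  assumes "x * w = y * w" "w * w' = 1" shows "x = (y :: 'm)"
  using assms mult_right_cancel_monoid by blast

text \<open>This relation and the next two, \<open>e23_e13\<close> and \<open>e12_e23\<close>, arise
  from \<open>e31_e32\<close>, \<open>e12_e32\<close> and \<open>e31_e12\<close> by conjugation with
  \<open>T\<close> or \<open>T * J\<close>, which permutes the roots.\<close>

lemma e12_e13: "e12 a * e13 b = e13 b * e12 a"
proof (rule transport)
  show "e12 a * e13 b * T = e13 b * e12 a * T"
    using arg_cong[OF e31_e32[of b a], of "\<lambda>x. T * x"] by (simp add: JT_rules mult.assoc)
qed (rule TT)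

lemma e23_e13: "e23 a * e13 b = e13 b * e23 a"
proof (rule transport)
  show "e23 a * e13 b * (T * J) = e13 b * e23 a * (T * J)"
    using arg_cong[OF e12_e32[of a b], of "\<lambda>x. T * (J * x)"] by (simp add: JT_rules mult.assoc)
  show "T * J * (J * T) = 1" by (simp add: JT_rules mult.assoc)
qed

lemma e12_e23: "e12 a * e23 b = e13 (a * b) * (e23 b * e12 a)"
proof -
  have "T * (J * (e31 a * e12 b)) = T * (J * (e12 b * (e32 (b * a) * e31 a)))"
    by (simp only: e31_e12)
  then have "e12 a * (e23 b * (T * J)) = e13 (b * a) * (e23 b * (e12 a * (T * J)))"
    by (simp only: JT_e mult.assoc e23_e13[THEN mult_extend])
  then have "e12 a * e23 b * (T * J) = e13 (a * b) * (e23 b * e12 a) * (T * J)"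
    by (simp only: mult.assoc mult.commute[of b a])
  moreover have "T * J * (J * T) = 1" by (simp add: JT_cancel mult.assoc)
  ultimately show ?thesis by (rule transport)
qed

section \<open>The upper unitriangular group\<close>

definition U where "U c b a = e13 c * (e23 b * e12 a)"

lemmas e_commute = e12_e13 e23_e13 e12_e23
lemmas e_rules = e_add' e_0 e_commute e_commute[THEN mult_extend]

text \<open>The order of the factors in \<open>U\<close> makes \<open>a\<close>, \<open>b\<close>,
  \<open>c\<close> the entries (1,2), (2,3), (1,3) of its matrix, so this is the product rule of
  unitriangular matrices. The term \<open>a * b'\<close> is the commutator in
  \<open>e12_e23\<close>.\<close>

lemma U_mult: "U c b a * U c' b' a' = U (c + c' + a * b') (b + b') (a + a')"
proof -
  have "U c b a * U c' b' a' = e13 c * (e23 b * (e12 a * (e13 c' * (e23 b' * e12 a'))))"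
    by (simp add: U_def mult.assoc)
  also have "\<dots> = e13 c * (e13 c' * (e13 (a * b') * (e23 b * (e23 b' * (e12 a * e12 a')))))"
    by (simp only: e_commute e_commute[THEN mult_extend] mult.assoc)
  also have "\<dots> = e13 (c + c' + a * b') * (e23 (b + b') * e12 (a + a'))"
    by (simp only: e_add' add.assoc)
  finally show ?thesis by (simp only: U_def)
qed

lemma U_0: "U 0 0 0 = 1" by (simp add: U_def e_0)

lemma e_as_U: "e12 a = U 0 0 a" "e23 b = U 0 b 0" "e13 c = U c 0 0"
  by (simp_all add: U_def e_0)

lemma D_U:
  assumes "x \<noteq> 0" "y \<noteq> 0"
  shows "D x y * U c b a = U (c * x^2 * y) (b * x * y^2) (a * x / y) * D x y"
  using assms by (simp add: U_def D_rules mult.assoc)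

section \<open>Bruhat forms and their closure under the generators\<close>

definition weyl :: "'m set" where "weyl = {1, J, T, J * T, T * J, J * T * J}"

text \<open>The right factor ranges over the whole unitriangular group, so the form is not unique,
  but closure under right multiplication by \<open>U\<close> is immediate.\<close>

definition bruhat :: "'m set" where
  "bruhat = {U c b a * (D x y * (w * U c' b' a')) | c b a x y w c' b' a'.
     x \<noteq> 0 \<and> y \<noteq> 0 \<and> w \<in> weyl}"

lemma bruhatI:
  assumes "w \<in> weyl" "x \<noteq> 0" "y \<noteq> 0" "m = U c b a * (D x y * (w * U c' b' a'))"
  shows "m \<in> bruhat"
  using assms unfolding bruhat_def by blast

lemma bruhatE:
  assumes "m \<in> bruhat"
  obtains c b a x y w c' b' a' where "w \<in> weyl" "x \<noteq> 0" "y \<noteq> 0"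
    "m = U c b a * (D x y * (w * U c' b' a'))"
  using assms unfolding bruhat_def by blast

lemma U_bruhat:
  assumes "m \<in> bruhat" shows "U c b a * m \<in> bruhat"
  using assms
proof (rule bruhatE)
  fix c' b' a' x y w c'' b'' a''
  assume "w \<in> weyl" "x \<noteq> 0" "y \<noteq> 0" "m = U c' b' a' * (D x y * (w * U c'' b'' a''))"
  then show ?thesis
    using bruhatI U_mult[THEN mult_extend] by metis
qed

lemma bruhat_U:
  assumes "m \<in> bruhat" shows "m * U c b a \<in> bruhat"
  using assms
proof (rule bruhatE)
  fix c' b' a' x y w c'' b'' a''
  assume *: "w \<in> weyl" "x \<noteq> 0" "y \<noteq> 0" "m = U c' b' a' * (D x y * (w * U c'' b'' a''))"
  have "m * U c b a = U c' b' a' * (D x y * (w * (U c'' b'' a'' * U c b a)))"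
    using * by (simp add: mult.assoc)
  then show ?thesis
    using bruhatI[OF *(1-3)] U_mult by metis
qed

lemma D_bruhat:
  assumes "m \<in> bruhat" "x \<noteq> 0" "y \<noteq> 0" shows "D x y * m \<in> bruhat"
  using assms(1)
proof (rule bruhatE)
  fix c b a x' y' w c' b' a'
  assume *: "w \<in> weyl" "x' \<noteq> 0" "y' \<noteq> 0" "m = U c b a * (D x' y' * (w * U c' b' a'))"
  have "D x y * m = U (c * x^2 * y) (b * x * y^2) (a * x / y) * (D (x * x') (y * y') * (w * U c' b' a'))"
    using * assms by (simp add: D_U[THEN mult_extend] D_mult[THEN mult_extend] mult.assoc)
  moreover have "x * x' \<noteq> 0" "y * y' \<noteq> 0" using * assms by auto
  ultimately show ?thesis using bruhatI[OF *(1)] by metis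
qed

lemma weyl_bruhat: "w \<in> weyl \<Longrightarrow> w \<in> bruhat"
  by (rule bruhatI[of w 1 1 w 0 0 0 0 0 0]) (simp_all add: U_0 D_1)

lemma e_bruhat:
  assumes "m \<in> bruhat" shows "e12 a * m \<in> bruhat" "e23 a * m \<in> bruhat" "e13 a * m \<in> bruhat"
  using assms by (simp_all add: e_as_U U_bruhat)

lemma bruhat_e:
  assumes "m \<in> bruhat" shows "m * e12 a \<in> bruhat" "m * e23 a \<in> bruhat" "m * e13 a \<in> bruhat"
  using assms by (simp_all add: e_as_U bruhat_U)

lemma weyl_closed: "w \<in> weyl \<Longrightarrow> J * w \<in> weyl" "w \<in> weyl \<Longrightarrow> T * w \<in> weyl"
  unfolding weyl_def by (elim insertE; simp add: JT_cancel JT_braid JT_braid' mult.assoc)+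

text \<open>If \<^term>\<open>w\<close> keeps the simple root positive then \<^term>\<open>e12 a\<close> passes through \<^term>\<open>w\<close>;
  otherwise \<^term>\<open>J * w\<close> does, and \<^term>\<open>J * e12 a * J = e21 a\<close> is in the big cell of rank one.\<close>

lemma J_e12_weyl:
  assumes "w \<in> weyl" shows "J * (e12 a * w) \<in> bruhat"
proof (cases "a = 0")
  case False
  have weyl: "T \<in> bruhat" "J \<in> bruhat" "T * J \<in> bruhat"
    by (rule weyl_bruhat; simp add: weyl_def)+
  have pos: "J * (e12 b * w) \<in> bruhat" if "w \<in> {1, J * T, J * T * J}" for b w
  proof -
    have "J * (e12 b * (J * T)) = T * e23 b" "J * (e12 b * (J * T * J)) = T * J * e13 b"
      by (simp_all add: JT_rules mult.assoc)
    then show ?thesis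
      using that bruhat_e(2)[OF weyl(1)] bruhat_e(1)[OF weyl(2)] bruhat_e(3)[OF weyl(3)] by auto
  qed
  have neg: "J * (e12 a * (J * w)) \<in> bruhat" if "w \<in> {1, J * T, J * T * J}" for w
  proof -
    have "J * (e12 a * (J * w)) = e21 a * w" by (simp add: JT_rules mult.assoc)
    then show ?thesis
      using pos[OF that] False by (simp add: e21_bruhat mult.assoc e_bruhat D_bruhat)
  qed
  have "w \<in> {1, J * T, J * T * J} \<or> J * w \<in> {1, J * T, J * T * J}"
    using assms by (auto simp: weyl_def JT_cancel mult.assoc)
  then show ?thesis using pos neg[of "J * w"] by (auto simp: JT_cancel)
qed (use assms in \<open>simp add: e_0 weyl_closed weyl_bruhat\<close>)

text \<open>The decomposition \<open>e21_bruhat\<close> conjugated by \<open>T * J\<close>.\<close>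

lemma e32_bruhat:
  assumes "b \<noteq> 0"
  shows "e32 b = e23 (inverse b) * (D (-1) (inverse b) * (J * (T * (J * e23 (inverse b)))))"
proof (rule transport)
  have "T * J * e21 b * (J * T) = T * J * (e12 (inverse b) * (D (inverse b) (- b) * (J * e12 (inverse b)))) * (J * T)"
    using e21_bruhat[OF assms] by simp
  then show "e32 b * (T * J * (J * T)) = e23 (inverse b) * (D (-1) (inverse b) * (J * (T * (J * e23 (inverse b))))) * (T * J * (J * T))"
    using assms by (simp add: JT_rules mult.assoc)
qed (simp add: JT_cancel mult.assoc)

text \<open>Since \<open>T\<close> is the reflection in the highest root, the second simple
  reflection is \<open>J * T * J\<close>. The dichotomy of \<open>J_e12_weyl\<close> is repeated for
  it: \<open>e23 b\<close> passes through \<open>w\<close> to a positive root element, or it does so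
  through \<open>J * T * J * w\<close>.\<close>

lemma P_e23_weyl:
  assumes "w \<in> weyl" shows "J * (T * (J * (e23 b * w))) \<in> bruhat"
proof (cases "b = 0")
  case False
  let ?P = "J * T * J"
  have weyl: "J * T * J \<in> bruhat" "J * T \<in> bruhat" "T \<in> bruhat"
    by (rule weyl_bruhat; simp add: weyl_def)+
  have pos: "?P * (e23 b * w) \<in> bruhat" if "w \<in> {1, J, T * J}" for b w
  proof -
    have "?P * (e23 b * J) = J * T * e13 b" "?P * (e23 b * (T * J)) = T * e12 b"
      by (simp_all add: JT_rules mult.assoc)
    then show ?thesis
      using that bruhat_e(2)[OF weyl(1)] bruhat_e(3)[OF weyl(2)] bruhat_e(1)[OF weyl(3)] by auto
  qed
  have neg: "?P * (e23 b * (?P * w)) \<in> bruhat" if "w \<in> {1, J, T * J}" for w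
  proof -
    have "?P * (e23 b * (?P * w)) = e32 b * w" by (simp add: JT_rules mult.assoc)
    then show ?thesis
      using pos[OF that] False by (simp add: e32_bruhat mult.assoc e_bruhat D_bruhat)
  qed
  have "w \<in> {1, J, T * J} \<or> ?P * w \<in> {1, J, T * J}"
    using assms by (auto simp: weyl_def JT_rules mult.assoc)
  then show ?thesis using pos neg[of "?P * w"] by (auto simp: JT_rules mult.assoc)
qed (use assms in \<open>simp add: e_0 weyl_closed weyl_bruhat\<close>)

text \<open>\<open>J\<close> exchanges \<open>e13\<close> and \<open>e23\<close>. The remaining
  factor \<open>e12\<close> is moved past the torus until it stands next to \<open>w\<close>, where
  \<open>J_e12_weyl\<close> applies.\<close>

lemma J_bruhat:
  assumes "m \<in> bruhat" shows "J * m \<in> bruhat"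
  using assms
proof (rule bruhatE)
  fix c b a x y w c' b' a'
  assume *: "w \<in> weyl" "x \<noteq> 0" "y \<noteq> 0" "m = U c b a * (D x y * (w * U c' b' a'))"
  have "m = e13 c * (e23 b * (D x y * (e12 (a * y / x) * (w * U c' b' a'))))"
    using * by (simp add: U_def D_rules mult.assoc)
  then have "J * m = e13 b * (e23 c * (D y x * (J * (e12 (a * y / x) * w) * U c' b' a')))"
    using * by (simp add: JT_rules D_rules e_commute e_commute[THEN mult_extend] mult.assoc)
  then show ?thesis
    using * by (simp add: e_bruhat D_bruhat bruhat_U J_e12_weyl)
qed

lemma P_bruhat:
  assumes "m \<in> bruhat" shows "J * (T * (J * m)) \<in> bruhat"
  using assms
proof (rule bruhatE)
  fix c b a x y w c' b' a'
  assume *: "w \<in> weyl" "x \<noteq> 0" "y \<noteq> 0" "m = U c b a * (D x y * (w * U c' b' a'))"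
  \<comment> \<open>Now \<open>e23\<close> has to stand next to the torus; moving it past
    \<open>e12\<close> costs the commutator \<open>a * b\<close>.\<close>
  have "U c b a = e13 (c - a * b) * (e12 a * e23 b)"
    by (simp add: U_def e_rules)
  then have "m = e13 (c - a * b) * (e12 a * (D x y * (e23 (b / (x * y^2)) * (w * U c' b' a'))))"
    using * by (simp add: D_rules mult.assoc)
  then have "J * (T * (J * m)) = e12 (c - a * b) * (e13 a * (D x (inverse (x * y)) *
      (J * (T * (J * (e23 (b / (x * y^2)) * w))) * U c' b' a')))"
    using * by (simp add: JT_rules D_rules mult.assoc field_simps power2_eq_square)
  then show ?thesis
    using * by (simp add: e_bruhat D_bruhat bruhat_U P_e23_weyl)
qed

text \<open>\<open>T\<close> is the product of simple reflections
  \<open>J * (J * T * J) * J\<close>.\<close>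

lemma T_bruhat:
  assumes "m \<in> bruhat" shows "T * m \<in> bruhat"
proof -
  have "T * m = J * (J * (T * (J * (J * m))))" by (simp add: JT_cancel)
  then show ?thesis using assms by (simp add: J_bruhat P_bruhat)
qed

lemma R_bruhat: "m \<in> bruhat \<Longrightarrow> a \<noteq> 0 \<Longrightarrow> R a * m \<in> bruhat"
  by (simp add: R_as_D D_bruhat)

lemma S_bruhat:
  assumes "m \<in> bruhat" shows "S * m \<in> bruhat"
proof -
  have "S * m = e12 1 * (D (-1) 1 * m)" by (simp add: S_as_e12[symmetric] mult.assoc[symmetric])
  then show ?thesis using assms by (simp add: e_bruhat D_bruhat)
qed

lemma one_bruhat: "1 \<in> bruhat" by (rule weyl_bruhat) (simp add: weyl_def)

end

section \<open>Explicit matrices of size three and the kernel of the matrix map\<close>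

abbreviation mat3 :: "'a \<Rightarrow> 'a \<Rightarrow> 'a \<Rightarrow> 'a \<Rightarrow> 'a \<Rightarrow> 'a \<Rightarrow> 'a \<Rightarrow> 'a \<Rightarrow> 'a::zero \<Rightarrow> 'a ^ 3 ^ 3" where
  "mat3 a b c d e f g h i \<equiv> vector [vector [a, b, c], vector [d, e, f], vector [g, h, i]]"

lemma mat3_mult:
  fixes a :: "'a::semiring_1"
  shows "mat3 a b c d e f g h i ** mat3 a' b' c' d' e' f' g' h' i' =
    mat3 (a * a' + b * d' + c * g') (a * b' + b * e' + c * h') (a * c' + b * f' + c * i')
      (d * a' + e * d' + f * g') (d * b' + e * e' + f * h') (d * c' + e * f' + f * i')
      (g * a' + h * d' + i * g') (g * b' + h * e' + i * h') (g * c' + h * f' + i * i')"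
  by (simp add: vec_eq_iff forall_3 matrix_matrix_mult_def sum_3)

lemma mat3_eq_iff:
  "mat3 a b c d e f g h i = mat3 a' b' c' d' e' f' g' h' i' \<longleftrightarrow>
    a = a' \<and> b = b' \<and> c = c' \<and> d = d' \<and> e = e' \<and> f = f' \<and> g = g' \<and> h = h' \<and> i = i'"
  by (auto simp: vec_eq_iff forall_3)

lemma mat_1_eq_mat3: "(mat 1 :: 'a::semiring_1 ^ 3 ^ 3) = mat3 1 0 0 0 1 0 0 0 1"
  by (simp add: vec_eq_iff forall_3 mat_def)

locale sl3_cover = sl3_relators R S J T reps
  for R :: "'a::field \<Rightarrow> 'm::monoid_mult" and S J T reps +
  fixes M :: "'m \<Rightarrow> 'a ^ 3 ^ 3"
  assumes M_1: "M 1 = mat 1" and M_mult: "M (m * n) = M m ** M n"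
    and M_R: "a \<noteq> 0 \<Longrightarrow> M (R a) = sl3_matrix (GenR a)"
    and M_S: "M S = sl3_matrix GenS" and M_J: "M J = sl3_matrix GenJ" and M_T: "M T = sl3_matrix GenT"
begin

lemma M_D: "x \<noteq> 0 \<Longrightarrow> y \<noteq> 0 \<Longrightarrow> M (D x y) = mat3 x 0 0 0 y 0 0 0 (inverse (x * y))"
  by (simp add: D_def Z_alt M_mult M_R M_J mat3_mult mat3_eq_iff field_simps)

lemma M_e12: "M (e12 a) = mat3 1 a 0 0 1 0 0 0 1"
  by (cases "a = 0") (simp_all add: e12_def M_1 mat_1_eq_mat3 M_mult M_R M_S mat3_mult mat3_eq_iff)

lemma M_U: "M (U c b a) = mat3 1 a c 0 1 b 0 0 1"
  by (simp add: U_def e13_def e23_def e21_def M_mult M_e12 M_J M_T mat3_mult mat3_eq_iff)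

text \<open>Conjugation by the left factor gathers the unitriangular parts on the right, leaving a
  diagonal, a Weyl and a unitriangular factor. Comparing the entries of their product with those of
  the identity forces each of them to be trivial.\<close>

lemma bruhat_kernel:
  assumes "m \<in> bruhat" "M m = mat 1" shows "m = 1"
  using assms(1)
proof (rule bruhatE)
  fix c b a x y w c' b' a'
  assume *: "w \<in> weyl" "x \<noteq> 0" "y \<noteq> 0" "m = U c b a * (D x y * (w * U c' b' a'))"
  \<comment> \<open>By \<open>U_mult\<close> these are inverse to each other.\<close>
  define u v where "u = U c b a" and "v = U (a * b - c) (- b) (- a)"
  have uv: "u * v = 1" "v * u = 1" by (simp_all add: u_def v_def U_mult U_0)
  obtain c'' b'' a'' where u: "U c' b' a' * u = U c'' b'' a''"
    unfolding u_def U_mult by blast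
  have m: "v * m * u = D x y * (w * U c'' b'' a'')"
    using uv by (simp add: * u_def[symmetric] u[symmetric] mult.assoc) (simp add: mult.assoc[symmetric])
  have "M (v * m * u) = M (v * u)" by (simp add: M_mult assms(2))
  then have "M (D x y * (w * U c'' b'' a'')) = mat3 1 0 0 0 1 0 0 0 1"
    by (simp add: uv M_1 mat_1_eq_mat3 m)
  moreover have "w \<in> {1, J, T, J * T, T * J, J * T * J}" using * by (simp add: weyl_def)
  ultimately have "w = 1 \<and> x = 1 \<and> y = 1 \<and> a'' = 0 \<and> b'' = 0 \<and> c'' = 0"
    using *(2,3)
    by (elim insertE) (simp_all add: M_mult M_1 mat_1_eq_mat3 M_D M_U M_J M_T mat3_mult mat3_eq_iff)
  then have "v * m * u = 1" by (simp add: m D_1 U_0)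
  then have "u * (v * m * u) * v = 1" by (simp add: uv)
  then show "m = 1" using uv(1) by (simp add: mult.assoc) (simp add: mult.assoc[symmetric])
qed

end

section \<open>The words and matrices of the presentation\<close>

lemma wpow_0: "wpow w 0 = []" and wpow_Suc: "wpow w (Suc n) = w @ wpow w n"
  by (simp_all add: wpow_def)

lemma sl3_words:
  "a \<noteq> 0 \<Longrightarrow> wR a \<in> words sl3_gens" "wS \<in> words sl3_gens" "wJ \<in> words sl3_gens"
  "wT \<in> words sl3_gens"
  by (auto simp: wR_def wS_def wJ_def wT_def sl3_gens_def)

lemma sl3_words':
  "a \<noteq> 0 \<Longrightarrow> wZ a \<in> words sl3_gens" "a \<noteq> 0 \<Longrightarrow> wE12 a \<in> words sl3_gens" "wW \<in> words sl3_gens"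
  by (simp_all add: wZ_def wE12_def wW_def sl3_words words_wpow)

lemma wcomm_words: "u \<in> words X \<Longrightarrow> v \<in> words X \<Longrightarrow> wcomm u v \<in> words X"
  by (simp add: wcomm_def)

lemmas sl3_words_all = sl3_words sl3_words' words_wpow wcomm_words

lemma sl3_relations_words:
  fixes reps :: "'a::field set"
  assumes "0 \<notin> reps"
  shows "sl3_relations reps \<subseteq> words sl3_gens \<times> words sl3_gens"
proof -
  have *: "a \<noteq> 0" if "a \<in> reps" for a using that assms by auto
  show ?thesis
    unfolding sl3_relations_def wrho_def wlambda_def
    by (auto simp: sl3_words_all dest!: *)
qed

lemma sl3_relations_mem:
  shows "(wpow wS 2, []) \<in> sl3_relations reps" "(wpow wJ 2, []) \<in> sl3_relations reps"
    "(wpow wT 2, []) \<in> sl3_relations reps"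
    "a \<notin> {0, 1} \<Longrightarrow> b \<notin> {0, 1} \<Longrightarrow> (wR a @ wR b, wR (a * b)) \<in> sl3_relations reps"
    "a \<notin> {0, 1} \<Longrightarrow> b \<notin> {0, 1} \<Longrightarrow> (wZ a @ wZ b, wZ (a * b)) \<in> sl3_relations reps"
    "a \<notin> {0, 1} \<Longrightarrow> b \<notin> {0, 1} \<Longrightarrow> (wcomm (wR a) (wZ b), []) \<in> sl3_relations reps"
    "a \<notin> {0, 1} \<Longrightarrow> (wcomm wS (wZ a), []) \<in> sl3_relations reps"
    "a \<notin> {0, 1} \<Longrightarrow> (wcomm wS (wR a), wE12 (1 - a)) \<in> sl3_relations reps"
    "(wpow (wJ @ wS) 3, []) \<in> sl3_relations reps" "(wpow (wT @ wJ) 3, []) \<in> sl3_relations reps"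
    "a \<notin> {0, 1} \<Longrightarrow> (wpow (wT @ wR a) 2, []) \<in> sl3_relations reps"
    "a \<notin> {0, 1} \<Longrightarrow> (wcomm (wZ a) wT, wpow (wR a) 3) \<in> sl3_relations reps"
    "a \<in> reps \<Longrightarrow> (wpow (wW @ wE12 a) 2, []) \<in> sl3_relations reps"
    "a \<in> reps \<Longrightarrow> (wW @ wJ @ wR a @ wW, wrho a @ wW @ wlambda a) \<in> sl3_relations reps"
  unfolding sl3_relations_def
  \<comment> \<open>The union nests to the left, so \<open>UnI1\<close> strips the last family until
    \<open>UnI2\<close>, or the initial finite set, fits.\<close>
  by (((rule UnI2, (rule insertI1 | (rule insertI2, rule insertI1))) |
    (rule insertI1 | (rule insertI2, rule insertI1) | (rule insertI2, rule insertI2, rule insertI1)) |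
    (rule UnI2, rule CollectI, intro exI conjI, rule HOL.refl, assumption+) | rule UnI1)+)+

lemma cube_class_representatives_nonzero: "cube_class_representatives A \<Longrightarrow> 0 \<notin> A"
  by (auto simp: cube_class_representatives_def)

lemma cube_class_representatives_cover:
  assumes "cube_class_representatives A" "c \<noteq> 0"
  shows "\<exists>a\<in>A. \<exists>k. k \<noteq> 0 \<and> a = c * k^3"
proof -
  have "cubes #>\<^bsub>units_group\<^esub> c \<in> carrier (units_group Mod cubes)"
    using assms(2) by (auto simp: FactGroup_def RCOSETS_def units_group_def)
  then obtain a where "a \<in> A" "a \<in> cubes #>\<^bsub>units_group\<^esub> c"
    using assms(1) unfolding cube_class_representatives_def by blast
  then show ?thesis
    by (auto simp: r_coset_def units_group_def cubes_def mult.commute)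
qed

text \<open>Inverse words are evaluated by exhibiting inverses of their values. Most relations
  concern parameters other than 1 and are completed here by the case 1, using \<open>R 1 = 1\<close>
  and \<open>Z 1 = 1\<close>.\<close>

lemma sl3_relators_of_words:
  fixes \<Phi> :: "'a::field sl3_gen word \<Rightarrow> 'm::monoid_mult"
  assumes reps: "cube_class_representatives reps"
    and \<Phi>_Nil: "\<Phi> [] = 1"
    and \<Phi>_append: "\<And>u v. u \<in> words sl3_gens \<Longrightarrow> v \<in> words sl3_gens \<Longrightarrow> \<Phi> (u @ v) = \<Phi> u * \<Phi> v"
    and \<Phi>_cong: "\<And>u v. (u, v) \<in> word_cong sl3_gens (sl3_relations reps) \<Longrightarrow> \<Phi> u = \<Phi> v"
  shows "sl3_relators (\<lambda>a. \<Phi> (wR a)) (\<Phi> wS) (\<Phi> wJ) (\<Phi> wT) reps"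
proof -
  have rel: "\<Phi> u = \<Phi> v" if "(u, v) \<in> sl3_relations reps" for u v
    using \<Phi>_cong[OF word_cong.relation[OF that, of "[]" sl3_gens "[]"]] by simp
  have pow: "\<Phi> (wpow w n) = \<Phi> w ^ n" if "w \<in> words sl3_gens" for w n
    using that by (induction n) (simp_all add: wpow_0 wpow_Suc \<Phi>_Nil \<Phi>_append words_wpow)
  have winv: "\<Phi> (winv w) * \<Phi> w = 1" if "w \<in> words sl3_gens" for w
    using \<Phi>_cong[OF word_cong_winv_left[OF that]] that by (simp add: \<Phi>_append \<Phi>_Nil)
  \<comment> \<open>In a monoid a left inverse and a right inverse of the same element
    coincide.\<close>
  have winv': "\<Phi> (winv w) = m" if "w \<in> words sl3_gens" "\<Phi> w * m = 1" for w m
    by (metis winv[OF that(1)] that(2) mult.assoc mult_1_left mult_1_right)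
  have comm: "\<Phi> (wcomm u v) * \<Phi> v = \<Phi> u * \<Phi> v * \<Phi> (winv u)"
    if "u \<in> words sl3_gens" "v \<in> words sl3_gens" for u v
    using that by (simp add: wcomm_def \<Phi>_append mult.assoc winv)
  have comm1: "\<Phi> u * \<Phi> v = \<Phi> v * \<Phi> u"
    if "\<Phi> (wcomm u v) = \<Phi> []" "u \<in> words sl3_gens" "v \<in> words sl3_gens" for u v
  proof -
    have "\<Phi> v * \<Phi> u = \<Phi> u * \<Phi> v * \<Phi> (winv u) * \<Phi> u"
      using comm[OF that(2,3)] that(1) by (simp add: \<Phi>_Nil)
    then show ?thesis using winv[OF that(2)] by (simp add: mult.assoc)
  qed
  define R where "R a = \<Phi> (wR a)" for a
  define S where "S = \<Phi> wS"
  define J where "J = \<Phi> wJ"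
  define T where "T = \<Phi> wT"
  define Z where "Z a = (J * R a)^2" for a
  note defs = R_def[symmetric] S_def[symmetric] J_def[symmetric] T_def[symmetric]
  note evals = pow \<Phi>_append \<Phi>_Nil sl3_words_all
  have sq: "S * S = 1" "J * J = 1" "T * T = 1"
    using sl3_relations_mem(1-3)[THEN rel]
    by (simp_all add: evals power2_eq_square defs)
  have sq': "S * (S * m) = m" "J * (J * m) = m" "T * (T * m) = m" for m
    by (simp_all add: mult.assoc[symmetric] sq)
  have R_1: "R 1 = 1" by (simp add: R_def wR_def \<Phi>_Nil)
  have R_mult: "R a * R b = R (a * b)" if "a \<noteq> 0" "b \<noteq> 0" for a b
  proof (cases "a = 1 \<or> b = 1")
    case False
    then have "a \<notin> {0, 1}" "b \<notin> {0, 1}" using that by auto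
    from rel[OF sl3_relations_mem(4)[OF this]] show ?thesis using that by (simp add: evals defs)
  qed (auto simp: R_1)
  have R_winv: "\<Phi> (winv (wR a)) = R (inverse a)" if "a \<noteq> 0" for a
    using that by (intro winv') (simp_all add: defs sl3_words R_mult R_1)
  have Z: "\<Phi> (wZ a) = Z a" if "a \<noteq> 0" for a
    using that by (simp add: wZ_def Z_def evals defs)
  have E12: "\<Phi> (wE12 a) = R a * (S * R (- inverse a))" if "a \<noteq> 0" for a
    using that by (simp add: wE12_def evals R_winv defs)
  have Z_1: "Z 1 = 1" by (simp add: Z_def R_1 power2_eq_square sq)
  have Z_mult: "Z a * Z b = Z (a * b)" if "a \<noteq> 0" "b \<noteq> 0" for a b
  proof (cases "a = 1 \<or> b = 1")
    case False
    then have "a \<notin> {0, 1}" "b \<notin> {0, 1}" using that by auto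
    from rel[OF sl3_relations_mem(5)[OF this]] show ?thesis using that by (simp add: evals Z)
  qed (auto simp: Z_1)
  have Z_winv: "\<Phi> (winv (wZ a)) = Z (inverse a)" if "a \<noteq> 0" for a
    using that by (intro winv') (simp_all add: Z sl3_words_all Z_mult Z_1)
  have R_Z: "R a * Z b = Z b * R a" if "a \<noteq> 0" "b \<noteq> 0" for a b
  proof (cases "a = 1 \<or> b = 1")
    case False
    then have "a \<notin> {0, 1}" "b \<notin> {0, 1}" using that by auto
    from comm1[OF rel[OF sl3_relations_mem(6)[OF this]]] show ?thesis using that by (simp add: sl3_words_all Z defs)
  qed (auto simp: R_1 Z_1)
  have S_Z: "S * Z a = Z a * S" if "a \<noteq> 0" for a
  proof (cases "a = 1")
    case False
    then have "a \<notin> {0, 1}" using that by auto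
    from comm1[OF rel[OF sl3_relations_mem(7)[OF this]]] show ?thesis using that by (simp add: sl3_words_all Z defs)
  qed (auto simp: Z_1)
  have S_R: "S * R a * S * R (inverse a) = R (1 - a) * S * R (- inverse (1 - a))"
    if "a \<noteq> 0" "a \<noteq> 1" for a
  proof -
    have "\<Phi> (wcomm wS (wR a)) = \<Phi> (wE12 (1 - a))"
      using that by (intro rel sl3_relations_mem) auto
    moreover have "\<Phi> (winv wS) = S" by (intro winv') (simp_all add: sl3_words sq defs)
    ultimately show ?thesis
      using that by (simp add: wcomm_def evals E12 R_winv defs mult.assoc)
  qed
  have braid: "J * S * J = S * J * S" "T * J * T = J * T * J"
  proof -
    have "J * (S * (J * (S * (J * S)))) = 1" "T * (J * (T * (J * (T * J)))) = 1"
      using sl3_relations_mem(9,10)[THEN rel]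
      by (simp_all add: evals power3_eq_cube defs mult.assoc)
    \<comment> \<open>The last three letters of each sixfold product are cancelled by multiplying
      with their reversal.\<close>
    from arg_cong[OF this(1), of "\<lambda>m. m * (S * (J * S))"] arg_cong[OF this(2), of "\<lambda>m. m * (J * (T * J))"]
    show "J * S * J = S * J * S" "T * J * T = J * T * J"
      by (simp_all add: mult.assoc sq sq')
  qed
  have T_R: "T * R a = R (inverse a) * T" if "a \<noteq> 0" for a
  proof (cases "a = 1")
    case False
    then have "a \<notin> {0, 1}" using that by auto
    from rel[OF sl3_relations_mem(11)[OF this]] have *: "T * (R a * (T * R a)) = 1"
      using that by (simp add: evals power2_eq_square defs mult.assoc)
    have "T * R a = R (inverse a) * R a * (T * R a)" using that by (simp add: R_mult R_1)
    also have "\<dots> = R (inverse a) * (T * (T * (R a * (T * R a))))" by (simp add: sq' mult.assoc)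
    finally show ?thesis by (simp add: *)
  qed (auto simp: R_1)
  have T_Z: "T * Z a = Z a * R (inverse (a^3)) * T" if "a \<noteq> 0" for a
  proof (cases "a = 1")
    case False
    then have "a \<notin> {0, 1}" using that by auto
    from rel[OF sl3_relations_mem(12)[OF this]] have "Z a * T * Z (inverse a) = R a ^ 3 * T"
      using comm[of "wZ a" wT] that by (simp add: evals Z Z_winv defs)
    moreover have "R a ^ 3 = R (a^3)" using that by (simp add: power3_eq_cube R_mult)
    ultimately have "R (inverse (a^3)) * (Z a * T * Z (inverse a)) * Z a
        = R (inverse (a^3)) * (R (a^3) * T) * Z a"
      by simp
    then show ?thesis
      using that by (simp add: mult.assoc Z_mult Z_1) (simp add: mult.assoc[symmetric] R_mult R_1 R_Z)
  qed (auto simp: Z_1 R_1)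
  have nz: "a \<noteq> 0" if "a \<in> reps" for a
    using that cube_class_representatives_nonzero[OF reps] by auto
  have W: "\<Phi> wW = T * (S * T)" by (simp add: wW_def evals defs)
  show ?thesis
    unfolding defs
  proof (unfold_locales, fold Z_def)
    fix a assume a: "a \<in> reps"
    from rel[OF sl3_relations_mem(13)[OF this]] show "(T * S * T * (R a * S * R (- inverse a)))\<^sup>2 = 1"
      using nz[OF a] by (simp add: evals W E12 mult.assoc)
    note rel[OF sl3_relations_mem(14)[OF a]]
    moreover have "\<Phi> (winv (wpow (wZ a) 2)) = Z (inverse a) * Z (inverse a)"
    proof (intro winv')
      have "a * a * (inverse a * inverse a) = 1" using nz[OF a] by (simp add: field_simps)
      then show "\<Phi> (wpow (wZ a) 2) * (Z (inverse a) * Z (inverse a)) = 1"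
        using nz[OF a] by (simp add: evals Z Z_mult Z_1 power2_eq_square)
    qed (simp add: nz[OF a] sl3_words_all)
    moreover have "(J * R (inverse a))^4 = Z (inverse a) * Z (inverse a)"
      unfolding Z_def power_add[symmetric] by simp
    ultimately show "T * S * T * J * R a * (T * S * T) =
      R (-a) * S * R (inverse a) * J * R a * (T * S * T) *
      (R (- inverse (a^2)) * S * R (a^2) * J * (R (a^2) * S * R (- inverse (a^2))) * R a ^ 4
       * (J * R (inverse a))^4)"
      using nz[OF a] by (simp add: wrho_def wlambda_def evals W E12 mult.assoc defs)
  qed (use sq R_1 R_mult Z_mult R_Z S_Z S_R braid T_R T_Z cube_class_representatives_nonzero[OF reps]
      cube_class_representatives_cover[OF reps] in auto)
qed


section \<open>The special linear group and soundness of the relations\<close>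

lemma group_special_linear_group: "group (special_linear_group :: ('a::field ^ 'n ^ 'n) monoid)"
proof (rule groupI)
  fix A :: "'a ^ 'n ^ 'n" assume "A \<in> carrier special_linear_group"
  then have A: "det A = 1" by (simp add: special_linear_group_def)
  then obtain B where B: "B ** A = mat 1"
    using invertible_det_nz[of A] by (auto simp: invertible_def)
  then have "det B = 1" using det_mul[of B A] A by simp
  then show "\<exists>B\<in>carrier special_linear_group. B \<otimes>\<^bsub>special_linear_group\<^esub> A = \<one>\<^bsub>special_linear_group\<^esub>"
    using B by (auto simp: special_linear_group_def)
qed (auto simp: special_linear_group_def det_mul matrix_mul_assoc)

lemma special_linear_group_simps:
  "A \<otimes>\<^bsub>special_linear_group\<^esub> B = A ** B" "\<one>\<^bsub>special_linear_group\<^esub> = mat 1"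
  "A \<in> carrier special_linear_group \<longleftrightarrow> det A = 1"
  by (simp_all add: special_linear_group_def)

lemma det_mat3:
  "det (mat3 a b c d e f g h i :: 'a::comm_ring_1 ^ 3 ^ 3) =
    a * e * i + b * f * g + c * d * h - a * f * h - b * d * i - c * e * g"
  by (simp add: det_3)

lemma sl3_matrix_closed:
  fixes x :: "'a::field sl3_gen"
  shows "x \<in> sl3_gens \<Longrightarrow> sl3_matrix x \<in> carrier special_linear_group"
  by (auto simp: sl3_gens_def special_linear_group_simps det_mat3)

abbreviation sl3_eval :: "'a::field sl3_gen word \<Rightarrow> 'a ^ 3 ^ 3" where
  "sl3_eval \<equiv> word_eval special_linear_group sl3_matrix"

lemmas sl3_eval_append =
  group.word_eval_append[OF group_special_linear_group sl3_matrix_closed, unfolded special_linear_group_simps]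

text \<open>Inverse words are evaluated by checking a candidate inverse with one matrix
  product.\<close>

lemma sl3_eval_winv:
  fixes w :: "'a::field sl3_gen word"
  assumes w: "w \<in> words sl3_gens" and B: "sl3_eval w ** B = mat 1"
  shows "sl3_eval (winv w) = B"
proof -
  interpret group "special_linear_group :: ('a ^ 3 ^ 3) monoid" by (rule group_special_linear_group)
  have A: "sl3_eval w \<in> carrier special_linear_group"
    by (rule word_eval_closed[OF sl3_matrix_closed w])
  then have "det B = 1"
    using arg_cong[OF B, of det] by (simp add: det_mul special_linear_group_simps)
  moreover have "B ** sl3_eval w = mat 1" using B matrix_left_right_inverse by blast
  ultimately show ?thesis
    using A inv_equality[of B "sl3_eval w"] word_eval_winv[OF sl3_matrix_closed w]
    by (simp add: special_linear_group_simps)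
qed

lemma sl3_eval_Nil: "sl3_eval [] = mat3 1 0 0 0 1 0 0 0 1"
  by (simp add: word_eval_def special_linear_group_simps mat_1_eq_mat3)

lemma sl3_eval_gens:
  "a \<noteq> 0 \<Longrightarrow> sl3_eval (wR a) = mat3 a 0 0 0 1 0 0 0 (inverse a)"
  "sl3_eval wS = mat3 (-1) 1 0 0 1 0 0 0 (-1)"
  "sl3_eval wJ = mat3 0 (-1) 0 (-1) 0 0 0 0 (-1)"
  "sl3_eval wT = mat3 0 0 (-1) 0 (-1) 0 (-1) 0 0"
  by (simp_all add: word_eval_def special_linear_group_simps wR_def wS_def wJ_def wT_def mat_1_eq_mat3
      mat3_mult)

lemma sl3_eval_wpow:
  "w \<in> words sl3_gens \<Longrightarrow> sl3_eval (wpow w (Suc n)) = sl3_eval w ** sl3_eval (wpow w n)"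
  "sl3_eval (wpow w 0) = mat3 1 0 0 0 1 0 0 0 1"
  by (simp_all add: wpow_0 wpow_Suc sl3_eval_append words_wpow sl3_eval_Nil)

lemmas sl3_eval_simps =
  sl3_eval_append sl3_eval_Nil sl3_eval_gens sl3_eval_wpow sl3_words_all mat3_mult numeral_eq_Suc

lemma sl3_eval_wZ: "a \<noteq> 0 \<Longrightarrow> sl3_eval (wZ a) = mat3 a 0 0 0 a 0 0 0 (inverse (a^2))"
  by (simp add: wZ_def sl3_eval_simps)

lemma sl3_eval_winv_gens:
  "a \<noteq> 0 \<Longrightarrow> sl3_eval (winv (wR a)) = mat3 (inverse a) 0 0 0 1 0 0 0 a"
  "sl3_eval (winv wS) = mat3 (-1) 1 0 0 1 0 0 0 (-1)"
  "sl3_eval (winv wT) = mat3 0 0 (-1) 0 (-1) 0 (-1) 0 0"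
  "a \<noteq> 0 \<Longrightarrow> sl3_eval (winv (wZ a)) = mat3 (inverse a) 0 0 0 (inverse a) 0 0 0 (a^2)"
  "a \<noteq> 0 \<Longrightarrow> sl3_eval (winv (wpow (wZ a) 2)) = mat3 (inverse (a^2)) 0 0 0 (inverse (a^2)) 0 0 0 (a^4)"
  by (rule sl3_eval_winv; simp add: sl3_eval_simps sl3_eval_wZ mat_1_eq_mat3 mat3_eq_iff;
      (simp add: field_simps)?)+

lemma sl3_eval_wE12: "a \<noteq> 0 \<Longrightarrow> sl3_eval (wE12 a) = mat3 1 a 0 0 1 0 0 0 1"
  by (simp add: wE12_def sl3_eval_simps sl3_eval_winv_gens mat3_eq_iff)

lemma sl3_relations_sound:
  fixes reps :: "'a::field set"
  assumes "0 \<notin> reps" "(u, v) \<in> sl3_relations reps"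
  shows "sl3_eval u = sl3_eval v"
proof -
  have *: "a \<noteq> 0" if "a \<in> reps" for a using that assms by auto
  \<comment> \<open>The rule for \<open>winv (wpow (wZ a) 2)\<close> is also supplied with unary
    numerals, because \<open>numeral_eq_Suc\<close> rewrites the exponent in the goal.\<close>
  note simps = sl3_eval_append sl3_eval_Nil sl3_eval_gens sl3_eval_wpow sl3_words_all
    sl3_eval_winv_gens sl3_eval_winv_gens(5)[unfolded numeral_2_eq_2] sl3_eval_wE12 sl3_eval_wZ wcomm_def wW_def wrho_def wlambda_def
    mat3_mult mat3_eq_iff
  show ?thesis
    using assms(2) unfolding sl3_relations_def
    by (elim UnE CollectE exE conjE Pair_inject insertE emptyE)
      (use * in \<open>simp_all add: simps numeral_eq_Suc field_simps\<close>)
qed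


section \<open>Generation of the special linear group by Gaussian elimination\<close>

definition sl3_generated :: "('a::field ^ 3 ^ 3) set" where
  "sl3_generated = sl3_eval ` words sl3_gens"

lemma sl3_generated_mult:
  assumes "A \<in> sl3_generated" "B \<in> sl3_generated" shows "A ** B \<in> sl3_generated"
proof -
  from assms obtain u v where "u \<in> words sl3_gens" "A = sl3_eval u" "v \<in> words sl3_gens" "B = sl3_eval v"
    by (auto simp: sl3_generated_def)
  then show ?thesis unfolding sl3_generated_def
    by (intro image_eqI[of _ _ "u @ v"]) (simp_all add: sl3_eval_append)
qed

lemma sl3_generated_gens:
  fixes a b :: "'a::field"
  shows "mat3 0 (-1) 0 (-1) 0 0 0 0 (-1 :: 'a) \<in> sl3_generated"
    "mat3 0 0 (-1) 0 (-1) 0 (-1) 0 (0 :: 'a) \<in> sl3_generated"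
    "mat3 1 a 0 0 1 0 0 0 1 \<in> sl3_generated"
    "a \<noteq> 0 \<Longrightarrow> b \<noteq> 0 \<Longrightarrow> mat3 a 0 0 0 b 0 0 0 (inverse (a * b)) \<in> sl3_generated"
proof -
  have I: "A \<in> sl3_generated" if "w \<in> words sl3_gens" "sl3_eval w = A" for w :: "'a sl3_gen word" and A
    using that by (auto simp: sl3_generated_def)
  show "mat3 0 (-1) 0 (-1) 0 0 0 0 (-1 :: 'a) \<in> sl3_generated"
    by (rule I[of wJ]) (simp_all add: sl3_eval_gens sl3_words)
  show "mat3 0 0 (-1) 0 (-1) 0 (-1) 0 (0 :: 'a) \<in> sl3_generated"
    by (rule I[of wT]) (simp_all add: sl3_eval_gens sl3_words)
  show "mat3 1 a 0 0 1 0 0 0 1 \<in> sl3_generated"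
  proof (cases "a = 0")
    case True then show ?thesis by (intro I[of "[]"]) (simp_all add: sl3_eval_Nil)
  next
    case False then show ?thesis by (intro I[of "wE12 a"]) (simp_all add: sl3_eval_wE12 sl3_words_all)
  qed
  show "mat3 a 0 0 0 b 0 0 0 (inverse (a * b)) \<in> sl3_generated" if "a \<noteq> 0" "b \<noteq> 0"
    by (rule I[of "wR (a / b) @ wZ b"])
      (use that in \<open>simp_all add: sl3_eval_append sl3_eval_gens sl3_eval_wZ sl3_words_all mat3_mult
        mat3_eq_iff field_simps power2_eq_square\<close>)
qed

lemma sl3_generated_conj:
  fixes A :: "'a::field ^ 3 ^ 3"
  assumes "A \<in> sl3_generated"
  shows "mat3 0 (-1) 0 (-1) 0 0 0 0 (-1) ** A ** mat3 0 (-1) 0 (-1) 0 0 0 0 (-1) \<in> sl3_generated"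
    "mat3 0 0 (-1) 0 (-1) 0 (-1) 0 0 ** A ** mat3 0 0 (-1) 0 (-1) 0 (-1) 0 0 \<in> sl3_generated"
  by (rule sl3_generated_mult[OF sl3_generated_mult[OF _ assms]]; rule sl3_generated_gens)+

lemma sl3_generated_elementary:
  fixes a :: "'a::field"
  shows "mat3 1 0 0 a 1 0 0 0 1 \<in> sl3_generated" "mat3 1 0 0 0 1 0 0 a 1 \<in> sl3_generated"
    "mat3 1 0 0 0 1 0 a 0 1 \<in> sl3_generated" "mat3 1 0 0 0 1 a 0 0 1 \<in> sl3_generated"
    "mat3 1 0 a 0 1 0 0 0 1 \<in> sl3_generated"
proof -
  note 12 = sl3_generated_gens(3)[of a]
  note conj = sl3_generated_conj[THEN back_subst[of "\<lambda>A. A \<in> sl3_generated"]]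
  show 21: "mat3 1 0 0 a 1 0 0 0 1 \<in> sl3_generated" by (rule conj(1)[OF 12]) (simp add: mat3_mult)
  show 32: "mat3 1 0 0 0 1 0 0 a 1 \<in> sl3_generated" by (rule conj(2)[OF 12]) (simp add: mat3_mult)
  show "mat3 1 0 0 0 1 0 a 0 1 \<in> sl3_generated" by (rule conj(1)[OF 32]) (simp add: mat3_mult)
  show 23: "mat3 1 0 0 0 1 a 0 0 1 \<in> sl3_generated" by (rule conj(2)[OF 21]) (simp add: mat3_mult)
  show "mat3 1 0 a 0 1 0 0 0 1 \<in> sl3_generated" by (rule conj(1)[OF 23]) (simp add: mat3_mult)
qed

text \<open>For \<open>e\<close> nonzero the matrix factors as lower, diagonal and upper, and the
  determinant fixes the last diagonal entry. Otherwise the last two rows are exchanged, up to sign,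
  by the matrix of \<open>J * T * J\<close>.\<close>

lemma sl3_generated_block:
  fixes a :: "'a::field"
  assumes "a * (e * i - f * h) = 1"
  shows "mat3 a 0 0 0 e f 0 h i \<in> sl3_generated"
proof -
  have pivot: "mat3 a 0 0 0 e f 0 h i \<in> sl3_generated" if "a * (e * i - f * h) = 1" "e \<noteq> 0" for a e f h i :: 'a
  proof -
    have a: "a \<noteq> 0" using that by auto
    have "e * i - f * h = inverse a" using inverse_unique[OF that(1)] by simp
    then have "i - f * h / e = inverse (a * e)"
      using that(2) by (metis diff_divide_distrib divide_inverse inverse_mult_distrib nonzero_mult_div_cancel_left)
    then have "mat3 a 0 0 0 e f 0 h i =
      mat3 1 0 0 0 1 0 0 (h / e) 1 ** mat3 a 0 0 0 e 0 0 0 (inverse (a * e)) ** mat3 1 0 0 0 1 (f / e) 0 0 1"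
      using that(2) by (simp add: mat3_mult mat3_eq_iff) (simp add: algebra_simps)
    then show ?thesis
      using a that(2) by (simp only:) (intro sl3_generated_mult sl3_generated_elementary sl3_generated_gens)
  qed
  show ?thesis
  proof (cases "e = 0")
    case True
    then have "h \<noteq> 0" using assms by auto
    then have "mat3 (-a) 0 0 0 (-h) (-i) 0 (-e) (-f) \<in> sl3_generated"
      by (intro pivot) (use assms in \<open>simp_all add: algebra_simps\<close>)
    moreover have "mat3 (-1) 0 0 0 0 (-1) 0 (-1) (0::'a) \<in> sl3_generated"
      using sl3_generated_conj(1)[OF sl3_generated_gens(2)] by (simp add: mat3_mult)
    ultimately have "mat3 (-1) 0 0 0 0 (-1) 0 (-1) 0 ** mat3 (-a) 0 0 0 (-h) (-i) 0 (-e) (-f) \<in> sl3_generated"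
      by (rule sl3_generated_mult[rotated])
    then show ?thesis by (simp add: mat3_mult)
  qed (use assms pivot in auto)
qed

text \<open>Some entry of the first column is nonzero; \<open>J\<close> or \<open>T\<close> brings
  it to the corner up to sign, and elementary matrices then clear its row and column.\<close>

lemma sl3_generated_all:
  fixes A :: "'a::field ^ 3 ^ 3"
  assumes "det A = 1" shows "A \<in> sl3_generated"
proof -
  have pivot: "mat3 a b c d e f g h i \<in> sl3_generated"
    if det: "det (mat3 a b c d e f g h i) = 1" and a: "a \<noteq> 0" for a b c d e f g h i :: 'a
  proof -
    define d' g' where "d' = d / a" and "g' = g / a"
    then have dg: "d = d' * a" "g = g' * a" using a by simp_all
    \<comment> \<open>The Schur complement of the pivot \<open>a\<close> has determinant
      \<open>inverse a\<close>.\<close>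
    have "a * ((e - d' * b) * (i - g' * c) - (f - d' * c) * (h - g' * b)) = 1"
      using det by (simp add: det_mat3 dg algebra_simps)
    from sl3_generated_block[OF this]
    have "mat3 1 0 0 d' 1 0 0 0 1 ** (mat3 1 0 0 0 1 0 g' 0 1 **
      mat3 a 0 0 0 (e - d' * b) (f - d' * c) 0 (h - g' * b) (i - g' * c) **
      (mat3 1 (b / a) 0 0 1 0 0 0 1 ** mat3 1 0 (c / a) 0 1 0 0 0 1)) \<in> sl3_generated"
      by (intro sl3_generated_mult sl3_generated_elementary sl3_generated_gens)
    then show ?thesis using a by (simp add: mat3_mult dg)
  qed
  obtain a b c d e f g h i where A: "A = mat3 a b c d e f g h i"
  proof
    show "A = mat3 (A$1$1) (A$1$2) (A$1$3) (A$2$1) (A$2$2) (A$2$3) (A$3$1) (A$3$2) (A$3$3)"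
      by (simp add: vec_eq_iff forall_3)
  qed
  have "\<not> (a = 0 \<and> d = 0 \<and> g = 0)" using assms by (auto simp: A det_mat3)
  then consider "a \<noteq> 0" | "a = 0" "d \<noteq> 0" | "a = 0" "d = 0" "g \<noteq> 0" by blast
  then show ?thesis
  proof cases
    case 1 then show ?thesis using assms unfolding A by (intro pivot)
  next
    case 2
    then have "mat3 (-d) (-e) (-f) (-a) (-b) (-c) (-g) (-h) (-i) \<in> sl3_generated"
      by (intro pivot) (use assms in \<open>simp_all add: A det_mat3 algebra_simps\<close>)
    from sl3_generated_mult[OF sl3_generated_gens(1) this] show ?thesis by (simp add: A mat3_mult)
  next
    case 3
    then have "mat3 (-g) (-h) (-i) (-d) (-e) (-f) (-a) (-b) (-c) \<in> sl3_generated"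
      by (intro pivot) (use assms in \<open>simp_all add: A det_mat3 algebra_simps\<close>)
    from sl3_generated_mult[OF sl3_generated_gens(2) this] show ?thesis by (simp add: A mat3_mult)
  qed
qed

section \<open>Completeness through the regular representation\<close>

datatype ('x, 'a) cover = Cover (act: "'x \<Rightarrow> 'x") (matrix_part: "'a ^ 3 ^ 3")

instantiation cover :: (type, semiring_1) monoid_mult
begin

definition times_cover :: "('a, 'b) cover \<Rightarrow> ('a, 'b) cover \<Rightarrow> ('a, 'b) cover" where
  "times_cover m n = Cover (act m \<circ> act n) (matrix_part m ** matrix_part n)"

definition one_cover :: "('a, 'b) cover" where
  "one_cover = Cover id (mat 1)"

instance
  by standard (simp_all add: times_cover_def one_cover_def comp_assoc matrix_mul_assoc)

end

text \<open>Pairing left multiplication with the matrix makes the matrix map a projection,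
  multiplicative by construction. Every word has a Bruhat form there, so
  \<open>bruhat_kernel\<close> applies, and the left regular representation is faithful.\<close>

lemma sl3_relations_complete:
  fixes reps :: "'a::field set"
  assumes reps: "cube_class_representatives reps"
    and w: "w \<in> words sl3_gens" "sl3_eval w = mat 1"
  shows "(w, []) \<in> word_cong sl3_gens (sl3_relations reps)"
proof -
  have nz: "0 \<notin> reps" by (rule cube_class_representatives_nonzero[OF reps])
  interpret presentation sl3_gens "sl3_relations reps"
    by unfold_locales (rule sl3_relations_words[OF nz])
  interpret P: group P by (rule group_P)
  \<comment> \<open>Outside the carrier \<open>L A\<close> is the identity, so that the class of the
    empty word acts as \<open>id\<close>.\<close>
  define L where "L A = (\<lambda>B. if B \<in> carrier P then A \<otimes>\<^bsub>P\<^esub> B else B)" for A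
  define \<Phi> where "\<Phi> w = Cover (L (cls w)) (sl3_eval w)" for w
  have cls: "cls u \<in> carrier P" if "u \<in> words sl3_gens" for u
    using that by (simp add: carrier_P)
  have \<Phi>_Nil: "\<Phi> [] = 1"
    by (auto simp: fun_eq_iff \<Phi>_def one_cover_def L_def one_P[symmetric] sl3_eval_Nil mat_1_eq_mat3)
  have \<Phi>_append: "\<Phi> (u @ v) = \<Phi> u * \<Phi> v" if "u \<in> words sl3_gens" "v \<in> words sl3_gens" for u v
    using that by (auto simp: fun_eq_iff \<Phi>_def times_cover_def L_def sl3_eval_append mult_P[symmetric] P.m_assoc cls)
  have \<Phi>_cong: "\<Phi> u = \<Phi> v" if "(u, v) \<in> word_cong sl3_gens (sl3_relations reps)" for u v
  proof -
    have "u \<in> words sl3_gens" "v \<in> words sl3_gens"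
      using word_cong_words[OF rels_words that] by auto
    then have "cls u = cls v" using that by (simp add: cls_eq_iff)
    moreover have "sl3_eval u = sl3_eval v"
      by (rule group.word_eval_cong[OF group_special_linear_group sl3_matrix_closed that rels_words
            sl3_relations_sound[OF nz]])
    ultimately show ?thesis by (simp add: \<Phi>_def)
  qed
  interpret sl3_relators "\<lambda>a. \<Phi> (wR a)" "\<Phi> wS" "\<Phi> wJ" "\<Phi> wT" reps
    by (rule sl3_relators_of_words[OF reps \<Phi>_Nil \<Phi>_append \<Phi>_cong])
  interpret sl3_cover "\<lambda>a. \<Phi> (wR a)" "\<Phi> wS" "\<Phi> wJ" "\<Phi> wT" reps matrix_part
    by unfold_locales (simp_all add: times_cover_def one_cover_def \<Phi>_def sl3_eval_gens)
  have letter: "\<Phi> [(x, e)] * m \<in> bruhat" if "x \<in> sl3_gens" "m \<in> bruhat" for x e m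
  proof -
    \<comment> \<open>Any right inverse of a letter is the value of its formal inverse; hence a
      formal inverse acts as \<open>S\<close>, \<open>J\<close>, \<open>T\<close> or some
      \<open>R (inverse a)\<close>.\<close>
    have inv: "\<Phi> [(x, False)] = n" if "\<Phi> [(x, True)] * n = 1" "x \<in> sl3_gens" for x n
    proof -
      have "\<Phi> [(x, False)] * \<Phi> [(x, True)] = \<Phi> ([(x, False)] @ [(x, True)])"
        using that(2) by (simp only: \<Phi>_append words_Cons words_Nil)
      also have "\<dots> = \<Phi> []"
        using word_cong.cancel[OF that(2), of "[]" "[]" False] by (simp add: \<Phi>_cong)
      finally have "\<Phi> [(x, False)] * (\<Phi> [(x, True)] * n) = n"
        by (simp add: \<Phi>_Nil mult.assoc[symmetric])
      then show ?thesis by (simp add: that(1))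
    qed
    from that(1) consider a where "x = GenR a" "a \<noteq> 0" "a \<noteq> 1" | "x = GenS" | "x = GenJ" | "x = GenT"
      by (auto simp: sl3_gens_def)
    then show ?thesis
    proof cases
      case 1
      then have R: "\<Phi> [(x, True)] = \<Phi> (wR a)" by (simp add: wR_def)
      then have "\<Phi> [(x, False)] = \<Phi> (wR (inverse a))"
        using 1 that(1) R_inverse(1) by (intro inv) simp_all
      then show ?thesis using 1 R that R_bruhat by (cases e) simp_all
    next
      case 2
      then have "\<Phi> [(x, True)] = \<Phi> wS" by (simp add: wS_def)
      moreover from this have "\<Phi> [(x, False)] = \<Phi> wS" using that(1) SS by (intro inv) simp_all
      ultimately show ?thesis using that S_bruhat by (cases e) simp_all
    next
      case 3
      then have "\<Phi> [(x, True)] = \<Phi> wJ" by (simp add: wJ_def)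
      moreover from this have "\<Phi> [(x, False)] = \<Phi> wJ" using that(1) JJ by (intro inv) simp_all
      ultimately show ?thesis using that J_bruhat by (cases e) simp_all
    next
      case 4
      then have "\<Phi> [(x, True)] = \<Phi> wT" by (simp add: wT_def)
      moreover from this have "\<Phi> [(x, False)] = \<Phi> wT" using that(1) TT by (intro inv) simp_all
      ultimately show ?thesis using that T_bruhat by (cases e) simp_all
    qed
  qed
  have "\<Phi> u \<in> bruhat" if "u \<in> words sl3_gens" for u
    using that
  proof (induction u)
    case Nil
    then show ?case by (simp add: \<Phi>_Nil one_bruhat)
  next
    case (Cons l u)
    then obtain x e where l: "l = (x, e)" "x \<in> sl3_gens" "u \<in> words sl3_gens" by (cases l) auto
    then have "\<Phi> (l # u) = \<Phi> [(x, e)] * \<Phi> u" using \<Phi>_append[of "[(x, e)]" u] by simp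
    then show ?case using letter l Cons by simp
  qed
  then have "\<Phi> w \<in> bruhat" using w by simp
  moreover have "matrix_part (\<Phi> w) = mat 1" using w by (simp add: \<Phi>_def)
  ultimately have "\<Phi> w = 1" by (rule bruhat_kernel)
  then have "L (cls w) = id" by (simp only: \<Phi>_def one_cover_def cover.inject)
  \<comment> \<open>Acting on the unit recovers the class of \<open>w\<close> from its left
    multiplication.\<close>
  from fun_cong[OF this, of "\<one>\<^bsub>P\<^esub>"] have "cls w = \<one>\<^bsub>P\<^esub>"
    using cls[OF w(1)] by (simp add: L_def)
  then show ?thesis using w cls_eq_iff[of w "[]"] by (simp only: one_P words_Nil)
qed

theorem theorem5p8:
  fixes reps :: "'a::field set"
  assumes "cube_class_representatives reps" and "1 \<in> reps"
  shows "has_presentation (special_linear_group :: ('a ^ 3 ^ 3) monoid) sl3_matrix sl3_gens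
    (sl3_relations reps)"
proof -
  interpret group "special_linear_group :: ('a ^ 3 ^ 3) monoid" by (rule group_special_linear_group)
  have nz: "0 \<notin> reps" by (rule cube_class_representatives_nonzero[OF assms(1)])
  show ?thesis
  proof (rule has_presentationI[OF sl3_matrix_closed sl3_relations_words[OF nz] sl3_relations_sound[OF nz]])
    show "(w, []) \<in> word_cong sl3_gens (sl3_relations reps)"
      if "w \<in> words sl3_gens" "sl3_eval w = \<one>\<^bsub>special_linear_group\<^esub>" for w
      using that sl3_relations_complete[OF assms(1)] by (simp add: special_linear_group_simps)
    show "carrier special_linear_group \<subseteq> sl3_eval ` words sl3_gens"
      using sl3_generated_all by (auto simp: special_linear_group_simps sl3_generated_def)
  qed
qed

end
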